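(* Let $m=2k$ with $k\in\mathbb{N}$, and consider the even-order heat equation $$\frac{\partial u(t,x)}{\partial t}=(-1)^{\frac m2+1}\frac{\partial^m u(t,x)}{\partial x^m},\qquad t>0,\ x\in\mathbb{R},$$ with random initial condition $u(0,x)=\eta(x)=M(x)+\xi(x)$. Its solution is the random field $$u(t,x)=\int_{\mathbb{R}} M(x-y)\,u_m(t,y)\,dy+\int_{\mathbb{R}} e^{i\lambda x-\lambda^m t}\sqrt{f(\lambda)}\,W(d\lambda),$$ where $u_m(t,y)=\frac{1}{2\pi}\int_{\mathbb{R}}e^{-i\alpha y-\alpha^m t}\,d\alpha$ is the fundamental solution. Suppose the covariance function of $\xi$ satisfies Assumption B with $A_0=0$. For $\varepsilon>0$ define $$U_\varepsilon(t,x)=\varepsilon^{-1/4}\Big(u\big(t\varepsilon^{-m/2},x\varepsilon^{-1/2}\big)-\mathbb{E}\,u\big(t\varepsilon^{-m/2},x\varepsilon^{-1/2}\big)\Big),\qquad t>0,\ x\in\mathbb{R}.$$ Then, as $\varepsilon\to0$, the finite-dimensional distributions of $U_\varepsilon$ converge weakly to those of the zero-mean Gaussian random field $$U_0(t,x)=\sqrt{C}\int_{\mathbb{R}}e^{i\lambda x-\lambda^m t}\,W(d\lambda),\qquad C:=\sum_{j=1}^n c_1(\kappa_j)A_jK_{\frac{\kappa_j-1}{2}}(|w_j|)\,|w_j|^{\frac{\kappa_j-1}{2}},$$ whose covariance function is $$\operatorname{Cov}(U_0(t,x),U_0(t',x'))=C\int_{\mathbb{R}}\cos(\lambda(x-x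'))e^{-(t+t')\lambda^m}d\lambda=\frac{2\sqrt{\pi}\,C}{m(t+t')^{1/m}}\;{}_1\Psi_1\!\left[\begin{array}{c}(1/m,\,2/m)\\(1/2,\,1)\end{array};-\frac{(x-x')^2}{4(t+t')^{2/m}}\right].$$
   Context: $(\Omega,\mathscr F,\mathbb P)$ is a complete probability space. $M:\mathbb{R}\to\mathbb{R}$ is a deterministic function for which the convolution integrals above are well defined. $\xi(x)$, $x\in\mathbb{R}$, is a real-valued, measurable, mean-square continuous, stationary Gaussian process with $\mathbb{E}\xi(x)=0$, $\mathbb{E}\xi^2(x)=1$, absolutely continuous spectral measure with spectral density $f$, and spectral representation $\xi(x)=\int_{\mathbb{R}}e^{i\lambda x}\sqrt{f(\lambda)}\,W(d\lambda)$, where $W$ is a complex Gaussian white-noise random measure on $\mathbb{R}$ chosen symmetric about the origin (so that all fields are real-valued), integrals being understood in $L_2(\Omega)$. Assumption B: the covariance function of $\xi$ is $r(x)=\sum_{j=0}^n A_j\frac{\cos(w_jx)}{(1+x^2)^{\kappa_j/2}}$, $x\in\mathbb{R}$, where $A_j\ge0$, $\sum_{j=0}^nA_j=1$, $w_0=0$, $w_j\neq0$ for $j\ge1$, and $\kappa_j\in(0,1)$ for $j=0,\dots,n$. Its spectral density is $$f(\lambda)=\sum_{j=0}^n\frac{c_1(\kappa_j)}{2}A_j\left(\frac{K_{\frac{\kappa_j-1}{2}}(|\lambda+w_j|)}{|\lambda+w_j|^{\frac{1-\kappa_j}{2}}}+\frac{K_{\frac{\kappa_j-1}{2}}(|\lambda-w_j|)}{|\lambda-w_j|^{\frac{1-\kappa_j}{2}}}\right),$$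 with $c_1(\kappa)=2^{\frac{1-\kappa}{2}}/(\sqrt{\pi}\,\Gamma(\kappa/2))$ and $K_\nu$ the modified Bessel function of the second kind. The Fox–Wright function is ${}_p\Psi_q\!\left[\begin{array}{c}(\alpha_1,A_1),\dots,(\alpha_p,A_p)\\(\beta_1,B_1),\dots,(\beta_q,B_q)\end{array};z\right]=\sum_{n=0}^\infty\frac{\prod_{j=1}^p\Gamma(\alpha_j+A_jn)}{\prod_{k=1}^q\Gamma(\beta_k+B_kn)}\frac{z^n}{n!}$ (with $A_j,B_k>0$, $1+\sum B_k-\sum A_j>0$). *)

theory Defs
  imports "HOL-Probability.Probability"
begin

text \<open>Modified Bessel function of the second kind, via its standard integral
  representation K_nu(z) = int_0^infty exp(-z cosh s) cosh(nu s) ds, for z > 0.\<close>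
definition bessel_K :: "real \<Rightarrow> real \<Rightarrow> real" where
  "bessel_K \<nu> z = (LBINT s:{0..}. exp (- z * cosh s) * cosh (\<nu> * s))"

definition c1 :: "real \<Rightarrow> real" where
  "c1 \<kappa> = 2 powr ((1 - \<kappa>) / 2) / (sqrt pi * Gamma (\<kappa> / 2))"

definition fox_wright_11 :: "real \<Rightarrow> real \<Rightarrow> real \<Rightarrow> real \<Rightarrow> real \<Rightarrow> real" where
  "fox_wright_11 a A b B z = (\<Sum>k. Gamma (a + A * real k) / Gamma (b + B * real k) * z ^ k / fact k)"

definition gaussian_rv :: "'a measure \<Rightarrow> ('a \<Rightarrow> real) \<Rightarrow> bool" where
  "gaussian_rv P X \<longleftrightarrow> X \<in> borel_measurable P \<and>
     ((\<exists>\<mu> \<sigma>. 0 < \<sigma> \<and> distributed P lborel X (normal_density \<mu> \<sigma>)) \<or>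
      (\<exists>c. AE \<omega> in P. X \<omega> = c))"

definition sq_int :: "(real \<Rightarrow> complex) \<Rightarrow> bool" where
  "sq_int g \<longleftrightarrow> g \<in> borel_measurable lborel \<and> integrable lborel (\<lambda>l. (cmod (g l))\<^sup>2)"

text \<open>I g plays the role of the stochastic integral int g(lambda) W(d lambda) with respect
  to a complex Gaussian white-noise random measure W on R, symmetric about the origin
  (W(-A) = conj W(A)), i.e. the L2(Omega) isometric extension of W.\<close>
definition white_noise_integral :: "'a measure \<Rightarrow> ((real \<Rightarrow> complex) \<Rightarrow> 'a \<Rightarrow> complex) \<Rightarrow> bool" where
  "white_noise_integral P I \<longleftrightarrow>
     (\<forall>g. sq_int g \<longrightarrow> I g \<in> borel_measurable P) \<and>
     (\<forall>g h a b. sq_int g \<longrightarrow> sq_int h \<longrightarrow>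
        (AE \<omega> in P. I (\<lambda>l. a * g l + b * h l) \<omega> = a * I g \<omega> + b * I h \<omega>)) \<and>
     (\<forall>g. sq_int g \<longrightarrow> (AE \<omega> in P. I (\<lambda>l. cnj (g (- l))) \<omega> = cnj (I g \<omega>))) \<and>
     (\<forall>g. sq_int g \<longrightarrow> integrable P (I g) \<and> (LINT \<omega>|P. I g \<omega>) = 0) \<and>
     (\<forall>g h. sq_int g \<longrightarrow> sq_int h \<longrightarrow>
        integrable P (\<lambda>\<omega>. I g \<omega> * cnj (I h \<omega>)) \<and>
        (LINT \<omega>|P. I g \<omega> * cnj (I h \<omega>)) = (LINT l|lborel. g l * cnj (h l))) \<and>
     (\<forall>(gs :: nat \<Rightarrow> real \<Rightarrow> complex) N. (\<forall>i<N. sq_int (gs i)) \<longrightarrow>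
        gaussian_rv P (\<lambda>\<omega>. \<Sum>i<N. Re (I (gs i) \<omega>)))"

definition fund_sol :: "nat \<Rightarrow> real \<Rightarrow> real \<Rightarrow> complex" where
  "fund_sol m t y = (1 / (2 * pi)) *
     (LINT \<alpha>|lborel. exp (- \<i> * complex_of_real (\<alpha> * y) - complex_of_real (\<alpha> ^ m * t)))"

definition heat_sol :: "(real \<Rightarrow> real) \<Rightarrow> nat \<Rightarrow> (real \<Rightarrow> real) \<Rightarrow>
    ((real \<Rightarrow> complex) \<Rightarrow> 'a \<Rightarrow> complex) \<Rightarrow> real \<Rightarrow> real \<Rightarrow> 'a \<Rightarrow> complex" where
  "heat_sol M m f I t x \<omega> =
     (LINT y|lborel. complex_of_real (M (x - y)) * fund_sol m t y) +
     I (\<lambda>l. exp (\<i> * complex_of_real (l * x) - complex_of_real (l ^ m * t)) *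
             complex_of_real (sqrt (f l))) \<omega>"

text \<open>Rescaled centred field U_eps (real-valued; the field is real a.s.).\<close>
definition rescaled_field :: "'a measure \<Rightarrow> (real \<Rightarrow> real) \<Rightarrow> nat \<Rightarrow> (real \<Rightarrow> real) \<Rightarrow>
    ((real \<Rightarrow> complex) \<Rightarrow> 'a \<Rightarrow> complex) \<Rightarrow> real \<Rightarrow> real \<Rightarrow> real \<Rightarrow> 'a \<Rightarrow> real" where
  "rescaled_field P M m f I \<epsilon> t x \<omega> =
     Re (complex_of_real (\<epsilon> powr (- 1 / 4)) *
       (heat_sol M m f I (t * \<epsilon> powr (- real m / 2)) (x * \<epsilon> powr (- 1 / 2)) \<omega> -
        (LINT \<omega>'|P. heat_sol M m f I (t * \<epsilon> powr (- real m / 2)) (x * \<epsilon> powr (- 1 / 2)) \<omega>')))"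

definition limit_field :: "real \<Rightarrow> nat \<Rightarrow> ((real \<Rightarrow> complex) \<Rightarrow> 'a \<Rightarrow> complex) \<Rightarrow>
    real \<Rightarrow> real \<Rightarrow> 'a \<Rightarrow> real" where
  "limit_field C m I t x \<omega> =
     Re (complex_of_real (sqrt C) *
       I (\<lambda>l. exp (\<i> * complex_of_real (l * x) - complex_of_real (l ^ m * t))) \<omega>)"

definition const_C :: "nat \<Rightarrow> (nat \<Rightarrow> real) \<Rightarrow> (nat \<Rightarrow> real) \<Rightarrow> (nat \<Rightarrow> real) \<Rightarrow> real" where
  "const_C n A w \<kappa> = (\<Sum>j=1..n. c1 (\<kappa> j) * A j * bessel_K ((\<kappa> j - 1) / 2) \<bar>w j\<bar> *
                                 \<bar>w j\<bar> powr ((\<kappa> j - 1) / 2))"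

end

theory Submission
  imports Defs
begin

text \<open>
  The covariance function determines the spectral density almost everywhere
  (uniqueness of characteristic functions). Writing
  \<open>(1 + x\<^sup>2) powr (- \<kappa> / 2)\<close> as a Gamma mixture of Gaussians in \<open>x\<close> shows that this density has a
  version \<open>g\<close> which is continuous at \<open>0\<close>, because \<open>A 0 = 0\<close> removes the only singularity there, and
  that \<open>g 0 = C\<close>.

  The substitution \<open>l \<mapsto> sqrt \<epsilon> * l\<close> turns the integrand of the rescaled field into
  \<open>exp (\<i> l x - l\<^sup>m t) * sqrt (g (sqrt \<epsilon> * l))\<close> without changing covariances, hence without changing
  the finite-dimensional Gaussian laws. On the fixed probability space these new integrals converge
  in \<open>L\<^sup>2\<close> to the limit field, since \<open>g\<close> is continuous at \<open>0\<close> and the factor \<open>exp (- l\<^sup>m t)\<close> kills the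
  contribution of \<open>sqrt \<epsilon> * \<bar>l\<bar> \<ge> \<delta>\<close>. The Fox--Wright formula is the termwise integration of the
  cosine series.
\<close>

subsection \<open>Integrals by substitution and the Fox--Wright series\<close>

text \<open>Replacing the frequency variable changes the integrand, and \<open>I\<close> of the new
  integrand is a different random variable with the same law. Hence weak convergence is split into
  an equality in law at each fixed \<open>\<epsilon>\<close>, which rests on uniqueness of
  characteristic functions in \<open>real ^ 'n\<close>, and a mean-square limit among variables on
  the same \<open>P\<close>. The factor \<open>\<epsilon> powr (- 1 / 4)\<close> is forced: its
  square cancels the Jacobian \<open>sqrt \<epsilon>\<close> of the substitution. The assumed
  \<open>f\<close> is known only through its Fourier transform, so the single value
  \<open>f 0\<close> says nothing; the constant in the limit is the value at 0 of one particular
  version. That version is built from a Gaussian mixture because positivity, measurability,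
  continuity off the singularity and the Fourier transform can all be read off the mixture. The
  density may be unbounded near \<open>w j\<close> and \<open>- w j\<close>, and under rescaling
  these points move off to infinity. No fixed majorant for the rescaled integrands is at hand; the
  far frequencies are controlled by the total mass of the density against the damping
  factor.\<close>

lemma has_bochner_integral_substitution:
  fixes f g g' :: "real \<Rightarrow> real"
  assumes [measurable]: "f \<in> borel_measurable borel" "g \<in> borel_measurable borel"
      "g' \<in> borel_measurable borel" "S \<in> sets borel" "T \<in> sets borel"
    and der: "\<And>x. x \<in> S \<Longrightarrow> (g has_field_derivative g' x) (at x)"
    and inj: "inj_on g S" and img: "g ` S = T"
  shows "has_bochner_integral lborel (\<lambda>x. indicator T x * f x) b \<longleftrightarrow>
         has_bochner_integral lborel (\<lambda>x. indicator S x * (\<bar>g' x\<bar> * f (g x))) b"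
proof -
  \<comment> \<open>For Borel data, integration against \<open>lborel\<close> and against its
    completion agree; the change of variables theorem is available for the completed
    measure.\<close>
  have *: "has_bochner_integral lborel (\<lambda>x. indicator X x * F x) b \<longleftrightarrow>
      F absolutely_integrable_on X \<and> integral X F = b"
    if [measurable]: "F \<in> borel_measurable borel" "X \<in> sets borel" for F :: "real \<Rightarrow> real" and X
  proof -
    have 1: "integrable lborel (\<lambda>x. indicator X x * F x) \<longleftrightarrow> F absolutely_integrable_on X"
      unfolding set_integrable_def by (subst integrable_completion) auto
    have 2: "integral X F = integral\<^sup>L lborel (\<lambda>x. indicator X x * F x)"
      if "F absolutely_integrable_on X"
      using set_lebesgue_integral_eq_integral(2)[OF that] unfolding set_lebesgue_integral_def
      by (subst (asm) integral_completion) auto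
    show ?thesis using 1 2 by (auto simp: has_bochner_integral_iff)
  qed
  have "S \<in> sets lebesgue" by (simp add: sets_completionI_sets)
  then show ?thesis
    using has_absolute_integral_change_of_variables_1'[of S g g' f b] inj img der
    by (subst (1 2) *) (auto intro: has_field_derivative_at_within)
qed

text \<open>The substitution \<open>t = T * l ^ m\<close> in Euler's integral for
  \<open>Gamma a\<close> with \<open>a = (p + 1) / m\<close>. It serves three times: for the moments
  of the even-order damping, for the total mass of the Gaussian mixture (\<open>m = 1\<close>,
  \<open>T = 1\<close>), and for its Fourier transform (\<open>m = 1\<close>,
  \<open>T = 1 + x\<^sup>2\<close>).\<close>

lemma has_bochner_integral_powr_exp:
  fixes p T :: real and m :: nat
  assumes "p > -1" "T > 0" "m \<ge> 1"
  shows "has_bochner_integral lborel (\<lambda>l. indicator {0<..} l * (l powr p * exp (- T * l ^ m)))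
     (Gamma ((p + 1) / m) / (m * T powr ((p + 1) / m)))"
proof -
  define a where "a = (p + 1) / m"
  have a: "a > 0" using assms by (simp add: a_def)
  have ma: "m * a = p + 1" using assms by (simp add: a_def)
  have 1: "has_bochner_integral lborel (\<lambda>t. indicator {0<..} t * (t powr (a - 1) * exp (- t))) (Gamma a)"
  proof -
    have "integral\<^sup>N lborel (\<lambda>t. ennreal (indicator {0<..} t * (t powr (a - 1) * exp (- t)))) =
          integral\<^sup>N lborel (\<lambda>t. ennreal (indicator {0..} t * t powr (a - 1) / exp t))"
      using AE_lborel_singleton[of "0::real"]
      by (intro nn_integral_cong_AE) (auto simp: indicator_def exp_minus field_simps elim!: eventually_mono)
    also have "\<dots> = ennreal (Gamma a)" using Gamma_conv_nn_integral_real[OF a] by simp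
    finally show ?thesis
      using a by (intro has_bochner_integral_nn_integral) (auto simp: less_imp_le)
  qed
  have img: "(\<lambda>l. T * l ^ m) ` {0<..} = {0<..}"
  proof safe
    fix s :: real assume "s > 0"
    then show "s \<in> (\<lambda>l. T * l ^ m) ` {0<..}"
      using assms by (intro image_eqI[of _ _ "root m (s / T)"]) (auto simp: real_root_gt_zero)
  qed (use assms in auto)
  have inj: "inj_on (\<lambda>l. T * l ^ m) {0<..}"
    using assms by (auto intro!: inj_onI simp: power_eq_iff_eq_base)
  have "has_bochner_integral lborel (\<lambda>l. indicator {0<..} l *
       (\<bar>T * (m * l ^ (m - 1))\<bar> * ((T * l ^ m) powr (a - 1) * exp (- (T * l ^ m))))) (Gamma a)"
    using 1 by (subst has_bochner_integral_substitution[OF _ _ _ _ _ _ inj img, symmetric])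
      (auto intro!: derivative_eq_intros)
  also have "(\<lambda>l::real. indicator {0<..} l *
       (\<bar>T * (m * l ^ (m - 1))\<bar> * ((T * l ^ m) powr (a - 1) * exp (- (T * l ^ m))))) =
     (\<lambda>l::real. (m * T powr a) * (indicator {0<..} l * (l powr p * exp (- T * l ^ m))))"
  proof
    fix l :: real
    have "T * (m * l ^ (m - 1)) * (T * l ^ m) powr (a - 1) = m * T powr a * l powr p" if l: "l > 0"
    proof -
      have "l ^ (m - 1) = l powr (real m - 1)"
        using l assms by (subst powr_realpow[symmetric]) (auto simp: of_nat_diff)
      moreover have "(l ^ m) powr (a - 1) = l powr (real m * (a - 1))"
        using l by (simp add: powr_powr flip: powr_realpow)
      \<comment> \<open>The Jacobian contributes \<open>m - 1\<close> and the integrand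
        \<open>m * (a - 1)\<close>; together they give \<open>m * a - 1 = p\<close>.\<close>
      moreover have "l powr (real m - 1) * l powr (real m * (a - 1)) = l powr p"
        by (simp add: ma right_diff_distrib flip: powr_add)
      moreover have "T * T powr (a - 1) = T powr a"
        using assms by (simp add: powr_mult_base)
      ultimately have "l ^ (m - 1) * (l ^ m) powr (a - 1) = l powr p" "T * T powr (a - 1) = T powr a"
        by simp_all
      moreover have "T * (m * l ^ (m - 1)) * (T * l ^ m) powr (a - 1) =
          m * (T * T powr (a - 1)) * (l ^ (m - 1) * (l ^ m) powr (a - 1))"
        using l assms by (simp add: powr_mult)
      ultimately show ?thesis by simp
    qed
    then show "indicator {0<..} l *
       (\<bar>T * (m * l ^ (m - 1))\<bar> * ((T * l ^ m) powr (a - 1) * exp (- (T * l ^ m)))) =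
      (m * T powr a) * (indicator {0<..} l * (l powr p * exp (- T * l ^ m)))"
      using assms by (auto simp: indicator_def)
  qed
  finally have "has_bochner_integral lborel (\<lambda>l. (1 / (m * T powr a)) * ((m * T powr a) * (indicator {0<..} l * (l powr p * exp (- T * l ^ m)))))
     (1 / (m * T powr a) * Gamma a)"
    by (intro has_bochner_integral_mult_right) auto
  moreover have "m * T powr a \<noteq> 0" using assms by auto
  ultimately show ?thesis by (simp add: a_def)
qed

lemma has_bochner_integral_even_moment:
  fixes T :: real and m j :: nat
  assumes "T > 0" "m \<ge> 1" "even m"
  shows "has_bochner_integral lborel (\<lambda>l. l ^ (2 * j) * exp (- T * l ^ m))
     (2 * Gamma ((2 * j + 1) / m) / (m * T powr ((2 * j + 1) / m)))"
proof -
  have "has_bochner_integral lborel (\<lambda>l. indicator {0..} l *\<^sub>R (l ^ (2 * j) * exp (- T * l ^ m)))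
     (Gamma ((2 * j + 1) / m) / (m * T powr ((2 * j + 1) / m)))"
  proof (subst has_bochner_integral_cong_AE)
    \<comment> \<open>For \<open>j = 0\<close> the two sides differ at the origin, where
      \<open>l ^ 0\<close> is 1 and the open half-line contributes 0.\<close>
    show "AE l in lborel. indicator {0..} l *\<^sub>R (l ^ (2 * j) * exp (- T * l ^ m)) =
        indicator {0<..} l * (l powr (2 * j) * exp (- T * l ^ m))"
      using AE_lborel_singleton[of "0::real"]
    proof eventually_elim
      case (elim l)
      show ?case
      proof (cases "l > 0")
        case True
        then have "l powr (2 * j) = l ^ (2 * j)" using powr_realpow[of l "2 * j"] by simp
        then show ?thesis using True by (simp add: indicator_def)
      qed (use elim in \<open>auto simp: indicator_def\<close>)
    qed
  qed (use has_bochner_integral_powr_exp[of "2 * j" T m] assms in \<open>auto simp: add.commute\<close>)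
  from has_bochner_integral_even_function[OF this] assms show ?thesis by simp
qed

section \<open>Gaussian domination of the even-order damping\<close>

lemma integrable_exp_neg_square: "(t::real) > 0 \<Longrightarrow> integrable lborel (\<lambda>l::real. exp (- t * l\<^sup>2))"
  using has_bochner_integral_even_moment[of t 2 0] by (auto simp: has_bochner_integral_iff)

text \<open>The \<open>- 1\<close> pays for \<open>\<bar>l\<bar> \<le> 1\<close>, where a higher
  power can fall below the square. Damping of order \<open>2 * k\<close> is thus Gaussian damping up
  to the factor \<open>exp t\<close>.\<close>

lemma square_le_even_power: "l\<^sup>2 - 1 \<le> (l::real) ^ (2 * k)" if "k \<ge> 1"
proof (cases "l\<^sup>2 \<le> 1")
  case True
  moreover have "0 \<le> l ^ (2 * k)" by simp
  ultimately show ?thesis by linarith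
next
  case False
  then have "(l\<^sup>2) ^ 1 \<le> (l\<^sup>2) ^ k" using that by (intro power_increasing) auto
  then show ?thesis by (simp add: power_mult)
qed

text \<open>Half of the Gaussian damping absorbs the exponential growth by completing the square,
  and the other half stays integrable. The growth factor is there because the absolute cosine series
  is bounded by \<open>exp \<bar>y * l\<bar>\<close>.\<close>

lemma integrable_exp_abs_even_power:
  fixes t y :: real
  assumes "t > 0" "k \<ge> 1"
  shows "integrable lborel (\<lambda>l. exp (\<bar>y * l\<bar>) * exp (- t * l ^ (2 * k)))"
proof (rule Bochner_Integration.integrable_bound)
  show "integrable lborel (\<lambda>l. exp (t + y\<^sup>2 / (2 * t)) * exp (- (t / 2) * l\<^sup>2))"
    using integrable_exp_neg_square[of "t / 2"] assms by auto
  have "\<bar>y * l\<bar> + - t * l ^ (2 * k) \<le> (t + y\<^sup>2 / (2 * t)) + - (t / 2) * l\<^sup>2" for l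
  proof -
    have "0 \<le> (\<bar>y\<bar> / t - \<bar>l\<bar>)\<^sup>2 * (t / 2)" using assms by simp
    also have "\<dots> = y\<^sup>2 / (2 * t) - \<bar>y * l\<bar> + (t / 2) * l\<^sup>2"
      using assms by (simp add: power2_diff power_divide abs_mult field_simps) (simp add: power2_eq_square)
    finally have "\<bar>y * l\<bar> \<le> y\<^sup>2 / (2 * t) + (t / 2) * l\<^sup>2" by simp
    moreover have "t * (l\<^sup>2 - 1) \<le> t * l ^ (2 * k)"
      using square_le_even_power[OF assms(2)] assms by (intro mult_left_mono) auto
    ultimately show ?thesis by (simp add: algebra_simps)
  qed
  then show "AE l in lborel. norm (exp (\<bar>y * l\<bar>) * exp (- t * l ^ (2 * k))) \<le>
      norm (exp (t + y\<^sup>2 / (2 * t)) * exp (- (t / 2) * l\<^sup>2))"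
    by (intro AE_I2) (simp flip: exp_add)
qed auto

lemma integrable_exp_even_power: "(t::real) > 0 \<Longrightarrow> k \<ge> 1 \<Longrightarrow> integrable lborel (\<lambda>l::real. exp (- t * l ^ (2 * k)))"
  using integrable_exp_abs_even_power[of t k 0] by simp

text \<open>Legendre duplication at half-integers. It trades the \<open>fact (2 * j)\<close> of the
  cosine series for the denominators \<open>Gamma (1 / 2 + j)\<close> and \<open>fact j\<close> of
  the Fox-Wright series, and produces the 4 in its argument.\<close>

lemma Gamma_half_plus_nat:
  "Gamma (1 / 2 + real j) * fact j * 4 ^ j = sqrt pi * fact (2 * j)"
proof (induction j)
  case 0 show ?case by (simp add: Gamma_one_half_real)
next
  case (Suc j)
  have "Gamma (1 / 2 + real (Suc j)) = (1 / 2 + real j) * Gamma (1 / 2 + real j)"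
  proof -
    have "1 / 2 + real j \<notin> \<int>\<^sub>\<le>\<^sub>0"
      using nonpos_Ints_nonpos[of "1 / 2 + real j"] by (auto simp: add_pos_nonneg)
    from Gamma_plus1[OF this] show ?thesis by (simp add: add_ac)
  qed
  then have "Gamma (1 / 2 + real (Suc j)) * fact (Suc j) * 4 ^ Suc j =
      ((1 / 2 + real j) * 4 * (1 + real j)) * (Gamma (1 / 2 + real j) * fact j * 4 ^ j)"
    by simp
  also have "\<dots> = sqrt pi * fact (2 * Suc j)"
    unfolding Suc by (simp add: algebra_simps)
  finally show ?case .
qed

theorem integral_cos_exp_even_power_fox_wright:
  fixes T y :: real
  assumes T: "T > 0" and k: "k \<ge> 1"
  shows "(LINT l|lborel. cos (l * y) * exp (- T * l ^ (2 * k))) =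
    2 * sqrt pi / (real (2 * k) * T powr (1 / real (2 * k))) *
      fox_wright_11 (1 / real (2 * k)) (2 / real (2 * k)) (1 / 2) 1
        (- y\<^sup>2 / (4 * T powr (2 / real (2 * k))))"
proof -
  define m where "m = 2 * k"
  have m: "m \<ge> 1" "even m" using k by (auto simp: m_def)
  define F where "F j l = (-1) ^ j * y ^ (2 * j) / fact (2 * j) * (l ^ (2 * j) * exp (- T * l ^ m))" for j and l :: real
  define c where "c j = (-1) ^ j * y ^ (2 * j) / fact (2 * j) *
     (2 * Gamma ((2 * j + 1) / m) / (m * T powr ((2 * j + 1) / m)))" for j :: nat
  have F: "has_bochner_integral lborel (F j) (c j)" for j
    unfolding F_def c_def
    by (intro has_bochner_integral_mult_right has_bochner_integral_even_moment T m)
  have sums_cos: "(\<lambda>j. F j l) sums (cos (l * y) * exp (- T * l ^ m))" for l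
  proof -
    have "(\<lambda>j. (if even j then (-1) ^ (j div 2) / fact j else 0) * (l * y) ^ j) sums cos (l * y)"
      using cos_converges[of "l * y"] by (simp add: cos_coeff_def)
    \<comment> \<open>The odd coefficients vanish, so the sum may be taken along the subsequence
      \<open>2 * j\<close>.\<close>
    then have "(\<lambda>j. (if even (2 * j) then (-1) ^ (2 * j div 2) / fact (2 * j) else 0) * (l * y) ^ (2 * j)) sums cos (l * y)"
      by (subst sums_mono_reindex[where g = "\<lambda>j. 2 * j"]) (auto simp: strict_mono_def image_iff elim!: evenE)
    then have "(\<lambda>j. (-1) ^ j / fact (2 * j) * (l * y) ^ (2 * j) * exp (- T * l ^ m)) sums (cos (l * y) * exp (- T * l ^ m))"
      by (intro sums_mult2) simp
    then show ?thesis by (simp add: F_def power_mult_distrib mult_ac)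
  qed
  \<comment> \<open>Without signs, the terms are the even part of the exponential series; one
    majorant therefore serves all partial sums.\<close>
  have bound: "norm (\<Sum>j<N. F j l) \<le> exp \<bar>y * l\<bar> * exp (- T * l ^ m)" for N l
  proof -
    have "norm (\<Sum>j<N. F j l) \<le> (\<Sum>j<N. norm (F j l))" by (rule norm_sum)
    also have "\<dots> = (\<Sum>j<N. \<bar>y * l\<bar> ^ (2 * j) / fact (2 * j)) * exp (- T * l ^ m)"
      unfolding sum_distrib_right
      by (intro sum.cong) (simp_all add: F_def abs_mult power_abs power_mult_distrib mult_ac)
    also have "(\<Sum>j<N. \<bar>y * l\<bar> ^ (2 * j) / fact (2 * j)) = (\<Sum>i\<in>(\<lambda>j. 2 * j) ` {..<N}. \<bar>y * l\<bar> ^ i / fact i)"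
      by (subst sum.reindex) (auto simp: inj_on_def)
    also have "\<dots> \<le> exp \<bar>y * l\<bar>"
      using sum_le_suminf[OF summable_exp_generic[of "\<bar>y * l\<bar>"], of "(\<lambda>j. 2 * j) ` {..<N}"]
      by (simp add: exp_def divide_inverse mult.commute)
    finally show ?thesis by simp
  qed
  have "(\<lambda>N. LINT l|lborel. (\<Sum>j<N. F j l)) \<longlonglongrightarrow> (LINT l|lborel. cos (l * y) * exp (- T * l ^ m))"
  proof (rule integral_dominated_convergence)
    show "integrable lborel (\<lambda>l. exp \<bar>y * l\<bar> * exp (- T * l ^ m))"
      unfolding m_def by (rule integrable_exp_abs_even_power[OF T k])
    show "AE l in lborel. (\<lambda>N. \<Sum>j<N. F j l) \<longlonglongrightarrow> cos (l * y) * exp (- T * l ^ m)"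
      using sums_cos by (simp add: sums_def)
    show "AE l in lborel. norm (\<Sum>j<N. F j l) \<le> exp \<bar>y * l\<bar> * exp (- T * l ^ m)" for N
      using bound by simp
  qed (auto simp: F_def)
  moreover have "(LINT l|lborel. (\<Sum>j<N. F j l)) = (\<Sum>j<N. c j)" for N
    using F by (subst Bochner_Integration.integral_sum) (auto simp: has_bochner_integral_iff)
  ultimately have c: "c sums (LINT l|lborel. cos (l * y) * exp (- T * l ^ m))"
    by (simp add: sums_def)
  \<comment> \<open>The prefactor collects what does not depend on \<open>j\<close>: the 2 from the
    two half-lines, \<open>sqrt pi\<close> from duplication, and \<open>T powr (1 / m)\<close> split
    off from \<open>T powr ((2 * j + 1) / m)\<close>.\<close>
  have c_eq: "c j = 2 * sqrt pi / (m * T powr (1 / m)) *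
     (Gamma (1 / m + 2 / m * j) / Gamma (1 / 2 + 1 * j) * (- y\<^sup>2 / (4 * T powr (2 / m))) ^ j / fact j)" for j
  proof -
    have 1: "T powr ((2 * j + 1) / m) = T powr (1 / m) * (T powr (2 / m)) ^ j"
      using T by (simp add: powr_realpow[symmetric] powr_powr add_divide_distrib field_simps flip: powr_add)
    have 2: "(2 * j + 1) / m = 1 / m + 2 / m * j" by (simp add: add_divide_distrib)
    have 3: "Gamma (1 / 2 + 1 * real j) > 0" by (intro Gamma_real_pos) (auto intro: add_pos_nonneg)
    have 4: "fact (2 * j) = Gamma (1 / 2 + 1 * real j) * fact j * 4 ^ j / sqrt pi"
      using Gamma_half_plus_nat[of j] by (simp add: field_simps)
    have 5: "(- y\<^sup>2 / (4 * T powr (2 / m))) ^ j = (-1) ^ j * y ^ (2 * j) / (4 ^ j * (T powr (2 / m)) ^ j)"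
    proof -
      have "(- y\<^sup>2 / (4 * T powr (2 / m))) ^ j = ((-1) * y\<^sup>2) ^ j / (4 * T powr (2 / m)) ^ j"
        by (simp only: power_divide mult_minus1)
      then show ?thesis by (simp only: power_mult_distrib power_mult)
    qed
    show ?thesis
      unfolding c_def 1 unfolding 2 4 5 using 3 m T by (simp add: field_simps)
  qed
  have "(\<lambda>j. Gamma (1 / m + 2 / m * j) / Gamma (1 / 2 + 1 * j) * (- y\<^sup>2 / (4 * T powr (2 / m))) ^ j / fact j)
     sums (m * T powr (1 / m) / (2 * sqrt pi) * (LINT l|lborel. cos (l * y) * exp (- T * l ^ m)))"
    using sums_mult[OF c, of "m * T powr (1 / m) / (2 * sqrt pi)"] m T unfolding c_eq by simp
  from sums_unique[OF this] show ?thesis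
    unfolding fox_wright_11_def m_def[symmetric] using m T by (simp add: field_simps)
qed

text \<open>With \<open>s = z / 2 * exp u\<close> the exponent
  \<open>s + z\<^sup>2 / (4 * s)\<close> becomes \<open>z * cosh u\<close>, and
  \<open>s powr (\<nu> - 1)\<close> times the Jacobian becomes
  \<open>(z / 2) powr \<nu> * exp (\<nu> * u)\<close>. The factor 2 appears because
  \<open>bessel_K\<close> integrates over half of the line.\<close>

lemma integral_powr_exp_bessel_K:
  fixes \<nu> z :: real
  assumes z: "z > 0"
    and int: "integrable lborel (\<lambda>s. indicator {0<..} s * (s powr (\<nu> - 1) * exp (- s - z\<^sup>2 / (4 * s))))"
  shows "(LINT s|lborel. indicator {0<..} s * (s powr (\<nu> - 1) * exp (- s - z\<^sup>2 / (4 * s)))) =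
     2 * (z / 2) powr \<nu> * bessel_K \<nu> z"
proof -
  define J where "J = (LINT s|lborel. indicator {0<..} s * (s powr (\<nu> - 1) * exp (- s - z\<^sup>2 / (4 * s))))"
  define E where "E u = exp (\<nu> * u) * exp (- z * cosh u)" for u
  have img: "(\<lambda>u. z / 2 * exp u) ` UNIV = {0<..}"
  proof safe
    fix s :: real assume "s > 0"
    then show "s \<in> range (\<lambda>u. z / 2 * exp u)"
      using z by (intro image_eqI[of _ _ "ln (2 * s / z)"]) auto
  qed (use z in auto)
  have inj: "inj_on (\<lambda>u. z / 2 * exp u) UNIV" using z by (auto simp: inj_on_def)
  have "has_bochner_integral lborel (\<lambda>s. indicator {0<..} s * (s powr (\<nu> - 1) * exp (- s - z\<^sup>2 / (4 * s)))) J"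
    using int by (simp add: has_bochner_integral_iff J_def)
  then have "has_bochner_integral lborel (\<lambda>u. indicator UNIV u * (\<bar>z / 2 * exp u\<bar> *
      ((z / 2 * exp u) powr (\<nu> - 1) * exp (- (z / 2 * exp u) - z\<^sup>2 / (4 * (z / 2 * exp u)))))) J"
    by (subst (asm) has_bochner_integral_substitution[OF _ _ _ _ _ _ inj img, where g' = "\<lambda>u. z / 2 * exp u"])
       (auto intro!: derivative_eq_intros)
  also have "(\<lambda>u. indicator UNIV u * (\<bar>z / 2 * exp u\<bar> *
      ((z / 2 * exp u) powr (\<nu> - 1) * exp (- (z / 2 * exp u) - z\<^sup>2 / (4 * (z / 2 * exp u)))))) =
      (\<lambda>u. (z / 2) powr \<nu> * E u)"
  proof
    fix u :: real
    have 1: "z / 2 * exp u * (z / 2 * exp u) powr (\<nu> - 1) = (z / 2) powr \<nu> * exp (\<nu> * u)"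
      using z powr_mult[of "z / 2" "exp u" \<nu>]
      by (subst powr_mult_base) (auto simp: exp_powr_real mult.commute)
    have 2: "- (z / 2 * exp u) - z\<^sup>2 / (4 * (z / 2 * exp u)) = - z * cosh u"
      using z by (simp add: cosh_def exp_minus field_simps power2_eq_square)
    show "indicator UNIV u * (\<bar>z / 2 * exp u\<bar> *
      ((z / 2 * exp u) powr (\<nu> - 1) * exp (- (z / 2 * exp u) - z\<^sup>2 / (4 * (z / 2 * exp u))))) =
      (z / 2) powr \<nu> * E u"
      unfolding 2 E_def using 1 z by (simp add: mult.assoc[symmetric])
  qed
  finally have "has_bochner_integral lborel (\<lambda>u. (1 / (z / 2) powr \<nu>) * ((z / 2) powr \<nu> * E u)) (1 / (z / 2) powr \<nu> * J)"
    by (rule has_bochner_integral_mult_right)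
  then have E: "has_bochner_integral lborel E (J / (z / 2) powr \<nu>)" using z by simp
  then have E': "has_bochner_integral lborel (\<lambda>u. E (- u)) (J / (z / 2) powr \<nu>)"
    using lborel_has_bochner_integral_real_affine_iff[of "-1" E "J / (z / 2) powr \<nu>" 0] by simp
  \<comment> \<open>Averaging with the reflection \<open>u \<mapsto> - u\<close> turns
    \<open>exp (\<nu> * u)\<close> into \<open>cosh (\<nu> * u)\<close> and leaves
    \<open>cosh u\<close> alone.\<close>
  have ch: "has_bochner_integral lborel (\<lambda>u. exp (- z * cosh u) * cosh (\<nu> * u)) (J / (z / 2) powr \<nu>)"
  proof -
    have "has_bochner_integral lborel (\<lambda>u. (E u + E (- u)) / 2) ((J / (z / 2) powr \<nu> + J / (z / 2) powr \<nu>) / 2)"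
      by (intro has_bochner_integral_divide_zero has_bochner_integral_add E E')
    then show ?thesis by (simp add: E_def cosh_def field_simps)
  qed
  have "set_integrable lborel {0..} (\<lambda>u. exp (- z * cosh u) * cosh (\<nu> * u))"
    using ch unfolding set_integrable_def
    by (intro integrable_mult_indicator) (auto simp: has_bochner_integral_iff)
  then have "has_bochner_integral lborel (\<lambda>u. indicator {0..} u *\<^sub>R (exp (- z * cosh u) * cosh (\<nu> * u))) (bessel_K \<nu> z)"
    unfolding bessel_K_def set_lebesgue_integral_def set_integrable_def by (simp add: has_bochner_integral_iff)
  from has_bochner_integral_even_function[OF this]
  have "has_bochner_integral lborel (\<lambda>u. exp (- z * cosh u) * cosh (\<nu> * u)) (2 * bessel_K \<nu> z)" by simp
  from has_bochner_integral_eq[OF this ch] show ?thesis unfolding J_def[symmetric] using z by (simp add: field_simps)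
qed

subsection \<open>The spectral density\<close>

text \<open>Integrated over \<open>l\<close>, this is \<open>2 * sqrt pi\<close> times the integrand of \<open>Gamma (\<kappa> / 2)\<close>. At \<open>l = 0\<close> it is not
  integrable in \<open>s\<close> for \<open>\<kappa> \<le> 1\<close>, so \<open>spectral_kernel \<kappa> 0\<close> below is the junk value \<open>0\<close>.\<close>

definition gamma_gauss :: "real \<Rightarrow> real \<Rightarrow> real \<Rightarrow> real" where
  "gamma_gauss \<kappa> l s = indicator {0<..} s * (s powr ((\<kappa> - 1) / 2 - 1) * exp (- s - l\<^sup>2 / (4 * s)))"

text \<open>The density of a centred normal variable with variance \<open>2 * s\<close>, where
  \<open>s\<close> is Gamma distributed with shape \<open>\<kappa> / 2\<close> and rate 1. The
  normal density contributes \<open>1 / (2 * sqrt (pi * s))\<close>, which lowers the Gamma exponent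
  \<open>\<kappa> / 2 - 1\<close> by one half.\<close>

definition spectral_kernel :: "real \<Rightarrow> real \<Rightarrow> real" where
  "spectral_kernel \<kappa> l = (LINT s|lborel. gamma_gauss \<kappa> l s) / (2 * sqrt pi * Gamma (\<kappa> / 2))"

lemma gamma_gauss_nonneg: "gamma_gauss \<kappa> l s \<ge> 0"
  by (simp add: gamma_gauss_def)

lemma gamma_gauss_antimono: "\<bar>a\<bar> \<le> \<bar>b\<bar> \<Longrightarrow> gamma_gauss \<kappa> b s \<le> gamma_gauss \<kappa> a s"
  by (auto simp: gamma_gauss_def indicator_def abs_le_square_iff intro!: mult_left_mono divide_right_mono)

lemma borel_measurable_gamma_gauss [measurable]:
  "(\<lambda>(s, l). gamma_gauss \<kappa> l s) \<in> borel_measurable (lborel \<Otimes>\<^sub>M lborel)"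
  "gamma_gauss \<kappa> l \<in> borel_measurable borel"
  unfolding gamma_gauss_def by measurable

section \<open>Fourier transform and regularity of the Gaussian mixture\<close>

lemma fourier_transform_gaussian:
  fixes s x :: real
  assumes s: "s > 0"
  shows "has_bochner_integral lborel
      (\<lambda>l. exp (\<i> * complex_of_real (l * x)) * complex_of_real (exp (- (l\<^sup>2 / (4 * s)))))
      (complex_of_real (2 * sqrt (pi * s) * exp (- s * x\<^sup>2)))"
proof -
  define t where "t = sqrt (2 * s) * x"
  have t2: "t\<^sup>2 / 2 = s * x\<^sup>2" using s by (simp add: t_def power_mult_distrib)
  have "integrable lborel (\<lambda>z. std_normal_density z *\<^sub>R iexp (t * z))"
    by (rule Bochner_Integration.integrable_bound[OF integrable_normal_density[of 1 0]]) auto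
  moreover have "(CLINT z|lborel. std_normal_density z *\<^sub>R iexp (t * z)) = complex_of_real (exp (- t\<^sup>2 / 2))"
    using fun_cong[OF char_std_normal_distribution, of t] unfolding char_def
    by (subst (asm) integral_density) auto
  ultimately have "has_bochner_integral lborel (\<lambda>z. std_normal_density z *\<^sub>R iexp (t * z)) (complex_of_real (exp (- t\<^sup>2 / 2)))"
    by (simp add: has_bochner_integral_iff)
  from has_bochner_integral_mult_right[OF this, of "complex_of_real (sqrt (2 * pi))"]
  have "has_bochner_integral lborel (\<lambda>z. complex_of_real (sqrt (2 * pi)) * (std_normal_density z *\<^sub>R iexp (t * z)))
    (complex_of_real (sqrt (2 * pi)) * complex_of_real (exp (- t\<^sup>2 / 2)))" by simp
  also have "(\<lambda>z. complex_of_real (sqrt (2 * pi)) * (std_normal_density z *\<^sub>R iexp (t * z))) =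
     (\<lambda>z. exp (\<i> * complex_of_real ((0 + sqrt (2 * s) * z) * x)) * complex_of_real (exp (- ((0 + sqrt (2 * s) * z)\<^sup>2 / (4 * s)))))"
    using s by (auto simp: fun_eq_iff std_normal_density_def t_def scaleR_conv_of_real power_mult_distrib mult_ac)
  also have "complex_of_real (sqrt (2 * pi)) * complex_of_real (exp (- t\<^sup>2 / 2)) =
      complex_of_real (2 * sqrt (pi * s) * exp (- s * x\<^sup>2)) /\<^sub>R \<bar>sqrt (2 * s)\<bar>"
    using s t2 by (simp add: real_sqrt_mult scaleR_conv_of_real field_simps flip: of_real_mult)
  finally show ?thesis
    using s by (subst lborel_has_bochner_integral_real_affine_iff[where c = "sqrt (2 * s)" and t = 0]) simp_all
qed

lemma has_bochner_integral_gaussian: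
  assumes "s > 0"
  shows "has_bochner_integral lborel (\<lambda>l. exp (- (l\<^sup>2 / (4 * s)))) (2 * sqrt (pi * s))"
  using has_bochner_integral_Re[OF fourier_transform_gaussian[OF assms, of 0]] by simp

text \<open>Integrating the Gaussian in \<open>l\<close> returns a factor \<open>sqrt s\<close>,
  which restores the exponent of the Gamma density with shape \<open>\<kappa> / 2\<close>.\<close>

lemma sqrt_gamma_exponent:
  "s > 0 \<Longrightarrow> s powr ((\<kappa> - 1) / 2 - 1) * sqrt (pi * s) = sqrt pi * s powr (\<kappa> / 2 - 1)"
  by (simp add: real_sqrt_mult powr_half_sqrt[symmetric] field_simps flip: powr_add)

text \<open>Integration in \<open>l\<close> comes inside: it is explicit for every \<open>s\<close>
  and leaves the integrand of \<open>Gamma (\<kappa> / 2)\<close>, so the value \<open>l = 0\<close>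
  never has to be treated separately.\<close>

lemma integrable_gamma_gauss_pair:
  assumes "0 < \<kappa>"
  shows "integrable (lborel \<Otimes>\<^sub>M lborel) (\<lambda>(s, l). gamma_gauss \<kappa> l s)"
proof (rule lborel_pair.Fubini_integrable)
  have *: "has_bochner_integral lborel (\<lambda>l. gamma_gauss \<kappa> l s)
      (2 * sqrt pi * (indicator {0<..} s * (s powr (\<kappa> / 2 - 1) * exp (- 1 * s ^ 1))))" for s
  proof (cases "s > 0")
    case True
    have "has_bochner_integral lborel (\<lambda>l. s powr ((\<kappa> - 1) / 2 - 1) * exp (- s) * exp (- (l\<^sup>2 / (4 * s))))
        (s powr ((\<kappa> - 1) / 2 - 1) * exp (- s) * (2 * sqrt (pi * s)))"
      by (intro has_bochner_integral_mult_right has_bochner_integral_gaussian True)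
    also have "(\<lambda>l. s powr ((\<kappa> - 1) / 2 - 1) * exp (- s) * exp (- (l\<^sup>2 / (4 * s)))) = (\<lambda>l. gamma_gauss \<kappa> l s)"
      using True by (simp add: gamma_gauss_def fun_eq_iff flip: exp_add)
    also have "s powr ((\<kappa> - 1) / 2 - 1) * exp (- s) * (2 * sqrt (pi * s)) =
        2 * (s powr ((\<kappa> - 1) / 2 - 1) * sqrt (pi * s)) * exp (- s)" by simp
    finally show ?thesis using True unfolding sqrt_gamma_exponent[OF True] by (simp add: mult_ac)
  next
    case False
    then have "indicator {0<..} s = (0::real)" by (simp add: indicator_def)
    then show ?thesis by (simp only: gamma_gauss_def mult_zero_left mult_zero_right has_bochner_integral_zero of_real_0 Bochner_Integration.integral_zero)
  qed
  have "(\<lambda>s. LINT l|lborel. norm (case (s, l) of (s, l) \<Rightarrow> gamma_gauss \<kappa> l s)) =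
      (\<lambda>s. (2 * sqrt pi * (indicator {0<..} s * (s powr (\<kappa> / 2 - 1) * exp (- 1 * s ^ 1)))))"
    by (simp only: prod.case real_norm_def abs_of_nonneg[OF gamma_gauss_nonneg] has_bochner_integral_integral_eq[OF *])
  moreover have "integrable lborel (\<lambda>s. indicator {0<..} s * (s powr (\<kappa> / 2 - 1) * exp (- 1 * s ^ 1)))"
    using has_bochner_integral_powr_exp[of "\<kappa> / 2 - 1" 1 1] assms by (auto simp: has_bochner_integral_iff)
  ultimately show "integrable lborel (\<lambda>s. LINT l|lborel. norm (case (s, l) of (s, l) \<Rightarrow> gamma_gauss \<kappa> l s))"
    by auto
  show "AE s in lborel. integrable lborel (\<lambda>l. case (s, l) of (s, l) \<Rightarrow> gamma_gauss \<kappa> l s)"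
    using * by (auto simp: has_bochner_integral_iff)
qed measurable

text \<open>Tonelli gives integrability for almost every \<open>l\<close> only; monotonicity in \<open>\<bar>l\<bar>\<close> upgrades this to all
  \<open>l \<noteq> 0\<close>.\<close>

lemma integrable_gamma_gauss:
  assumes "0 < \<kappa>" "l \<noteq> 0"
  shows "integrable lborel (gamma_gauss \<kappa> l)"
proof -
  have ae: "AE l in lborel. integrable lborel (gamma_gauss \<kappa> l)"
    using lborel_pair.AE_integrable_snd[OF integrable_gamma_gauss_pair[OF assms(1)]] by simp
  \<comment> \<open>An interval of positive length is not null, so it meets the almost sure set in
    some \<open>a\<close>, and \<open>a\<close> then dominates \<open>l\<close>.\<close>
  have "\<exists>a. 0 < a \<and> a < \<bar>l\<bar> \<and> integrable lborel (gamma_gauss \<kappa> a)"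
  proof (rule ccontr)
    assume "\<not> ?thesis"
    with ae have "AE a in lborel. a \<notin> {0<..<\<bar>l\<bar>}" by (auto elim!: eventually_mono)
    then have "{x. 0 < x \<and> x < \<bar>l\<bar>} \<in> null_sets lborel" by (subst (asm) AE_iff_null) auto
    moreover have "{x. 0 < x \<and> x < \<bar>l\<bar>} = {0<..<\<bar>l\<bar>}" by auto
    ultimately have "{0<..<\<bar>l\<bar>} \<in> null_sets lborel" by simp
    then show False using assms by auto
  qed
  then obtain a where "0 < a" "a < \<bar>l\<bar>" and a: "integrable lborel (gamma_gauss \<kappa> a)" by blast
  then show ?thesis
    by (intro Bochner_Integration.integrable_bound[OF a])
       (auto simp: gamma_gauss_nonneg intro!: gamma_gauss_antimono)
qed

lemma spectral_kernel_nonneg: "0 < \<kappa> \<Longrightarrow> 0 \<le> spectral_kernel \<kappa> l"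
  unfolding spectral_kernel_def
  by (intro divide_nonneg_nonneg Bochner_Integration.integral_nonneg gamma_gauss_nonneg mult_nonneg_nonneg less_imp_le[OF Gamma_real_pos]) auto

lemma borel_measurable_spectral_kernel [measurable]: "spectral_kernel \<kappa> \<in> borel_measurable borel"
proof -
  have "(\<lambda>(l, s). gamma_gauss \<kappa> l s) \<in> borel_measurable (borel \<Otimes>\<^sub>M lborel)"
    unfolding gamma_gauss_def by measurable
  then have [measurable]: "(\<lambda>l. LINT s|lborel. gamma_gauss \<kappa> l s) \<in> borel_measurable borel"
    by (intro lborel.borel_measurable_lebesgue_integral)
  show ?thesis unfolding spectral_kernel_def[abs_def] by measurable
qed

text \<open>On the open set of points with modulus above \<open>\<bar>l\<bar> / 2\<close>, the
  integrand at \<open>l / 2\<close> is a majorant; halving keeps the majorant away from the singular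
  frequency 0.\<close>

lemma isCont_spectral_kernel:
  assumes "0 < \<kappa>" "l \<noteq> 0"
  shows "isCont (spectral_kernel \<kappa>) l"
proof -
  define S where "S = {y. \<bar>y\<bar> > \<bar>l\<bar> / 2}"
  have "open S" unfolding S_def by (intro open_Collect_less continuous_intros)
  have "continuous_on S (spectral_kernel \<kappa>)"
    unfolding continuous_on_sequentially comp_def
  proof safe
    fix X and a assume X: "\<forall>n. X n \<in> S" "X \<longlonglongrightarrow> a"
    have "(\<lambda>n. LINT s|lborel. gamma_gauss \<kappa> (X n) s) \<longlonglongrightarrow> (LINT s|lborel. gamma_gauss \<kappa> a s)"
    proof (rule integral_dominated_convergence)
      show "integrable lborel (gamma_gauss \<kappa> (l / 2))" using assms by (intro integrable_gamma_gauss) auto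
      show "AE s in lborel. (\<lambda>n. gamma_gauss \<kappa> (X n) s) \<longlonglongrightarrow> gamma_gauss \<kappa> a s"
      proof (intro AE_I2)
        fix s :: real
        show "(\<lambda>n. gamma_gauss \<kappa> (X n) s) \<longlonglongrightarrow> gamma_gauss \<kappa> a s"
          by (cases "s > 0") (auto simp: gamma_gauss_def intro!: tendsto_intros X)
      qed
      show "AE s in lborel. norm (gamma_gauss \<kappa> (X n) s) \<le> gamma_gauss \<kappa> (l / 2) s" for n
      proof (intro AE_I2)
        fix s
        have "\<bar>l / 2\<bar> \<le> \<bar>X n\<bar>" using X(1) by (auto simp: S_def less_imp_le)
        from gamma_gauss_antimono[OF this] show "norm (gamma_gauss \<kappa> (X n) s) \<le> gamma_gauss \<kappa> (l / 2) s"
          by (simp add: gamma_gauss_nonneg)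
      qed
    qed auto
    then show "(\<lambda>n. spectral_kernel \<kappa> (X n)) \<longlonglongrightarrow> spectral_kernel \<kappa> a"
      unfolding spectral_kernel_def divide_inverse by (intro tendsto_mult tendsto_const)
  qed
  then show ?thesis using \<open>open S\<close> assms by (auto simp: continuous_on_eq_continuous_at S_def)
qed

text \<open>The origin of \<open>c1\<close>: the factor 2 of the Bessel integral cancels the 2 in
  the normalisation, and the halves in \<open>(\<bar>l\<bar> / 2) powr ((\<kappa> - 1) / 2)\<close>
  give \<open>2 powr ((1 - \<kappa>) / 2)\<close>.\<close>

lemma spectral_kernel_bessel_K:
  assumes "0 < \<kappa>" "l \<noteq> 0"
  shows "spectral_kernel \<kappa> l = c1 \<kappa> * bessel_K ((\<kappa> - 1) / 2) \<bar>l\<bar> * \<bar>l\<bar> powr ((\<kappa> - 1) / 2)"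
proof -
  have "(LINT s|lborel. gamma_gauss \<kappa> l s) = 2 * (\<bar>l\<bar> / 2) powr ((\<kappa> - 1) / 2) * bessel_K ((\<kappa> - 1) / 2) \<bar>l\<bar>"
    using integrable_gamma_gauss[OF assms] assms
    unfolding gamma_gauss_def
    by (subst integral_powr_exp_bessel_K[of "\<bar>l\<bar>" "(\<kappa> - 1) / 2", simplified power2_abs, symmetric]) auto
  moreover have "(\<bar>l\<bar> / 2) powr ((\<kappa> - 1) / 2) = \<bar>l\<bar> powr ((\<kappa> - 1) / 2) * 2 powr ((1 - \<kappa>) / 2)"
  proof -
    have "(1 - \<kappa>) / 2 = - ((\<kappa> - 1) / 2)" by (simp add: field_simps)
    then have "2 powr ((1 - \<kappa>) / 2) = 1 / 2 powr ((\<kappa> - 1) / 2)" by (simp only: powr_minus_divide)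
    then show ?thesis by (simp add: powr_divide)
  qed
  ultimately show ?thesis by (simp add: spectral_kernel_def c1_def)
qed

text \<open>For fixed \<open>s\<close> the Gaussian transforms to
  \<open>exp (- s * x\<^sup>2)\<close>, which merges with \<open>exp (- s)\<close> into a Gamma
  integral of rate \<open>1 + x\<^sup>2\<close>. Fubini exchanges the two integrations and also
  yields integrability in \<open>l\<close>.\<close>

lemma fourier_transform_spectral_kernel:
  assumes "0 < \<kappa>"
  shows "has_bochner_integral lborel
    (\<lambda>l. exp (\<i> * complex_of_real (l * x)) * complex_of_real (spectral_kernel \<kappa> l))
    (complex_of_real (1 / (1 + x\<^sup>2) powr (\<kappa> / 2)))"
proof -
  define G where "G = 2 * sqrt pi * Gamma (\<kappa> / 2)"
  have G: "G > 0" using assms by (simp add: G_def)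
  have m1: "(\<lambda>(s, l). exp (\<i> * complex_of_real (l * x)) * complex_of_real (gamma_gauss \<kappa> l s))
      \<in> borel_measurable (lborel \<Otimes>\<^sub>M lborel)"
    unfolding gamma_gauss_def by measurable
  have int: "integrable (lborel \<Otimes>\<^sub>M lborel) (\<lambda>(s, l). exp (\<i> * complex_of_real (l * x)) * complex_of_real (gamma_gauss \<kappa> l s))"
    by (rule Bochner_Integration.integrable_bound[OF integrable_gamma_gauss_pair[OF assms] m1])
       (auto simp: norm_mult)
  \<comment> \<open>This holds for every \<open>l\<close>: at \<open>l = 0\<close> with
    \<open>\<kappa> \<le> 1\<close> both sides are the default value 0.\<close>
  have inner: "(LINT s|lborel. exp (\<i> * complex_of_real (l * x)) * complex_of_real (gamma_gauss \<kappa> l s)) =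
     G * (exp (\<i> * complex_of_real (l * x)) * complex_of_real (spectral_kernel \<kappa> l))" for l
  proof -
    have "complex_of_real G * complex_of_real (spectral_kernel \<kappa> l) = complex_of_real (LINT s|lborel. gamma_gauss \<kappa> l s)"
      using G unfolding spectral_kernel_def G_def[symmetric] by simp
    then show ?thesis by (simp add: mult.left_commute)
  qed
  have inner': "(LINT l|lborel. exp (\<i> * complex_of_real (l * x)) * complex_of_real (gamma_gauss \<kappa> l s)) =
     complex_of_real (2 * sqrt pi * (indicator {0<..} s * (s powr (\<kappa> / 2 - 1) * exp (- (1 + x\<^sup>2) * s ^ 1))))" for s
  proof (cases "s > 0")
    case True
    have "(LINT l|lborel. exp (\<i> * complex_of_real (l * x)) * complex_of_real (gamma_gauss \<kappa> l s)) =
      (LINT l|lborel. complex_of_real (s powr ((\<kappa> - 1) / 2 - 1) * exp (- s)) *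
        (exp (\<i> * complex_of_real (l * x)) * complex_of_real (exp (- (l\<^sup>2 / (4 * s))))))"
    proof (intro Bochner_Integration.integral_cong refl)
      fix l
      have "gamma_gauss \<kappa> l s = s powr ((\<kappa> - 1) / 2 - 1) * exp (- s) * exp (- (l\<^sup>2 / (4 * s)))"
        using True by (simp add: gamma_gauss_def flip: exp_add)
      then show "exp (\<i> * complex_of_real (l * x)) * complex_of_real (gamma_gauss \<kappa> l s) =
         complex_of_real (s powr ((\<kappa> - 1) / 2 - 1) * exp (- s)) *
        (exp (\<i> * complex_of_real (l * x)) * complex_of_real (exp (- (l\<^sup>2 / (4 * s)))))"
        by (simp only: of_real_mult mult.left_commute)
    qed
    also have "\<dots> = complex_of_real (s powr ((\<kappa> - 1) / 2 - 1) * exp (- s)) *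
        complex_of_real (2 * sqrt (pi * s) * exp (- s * x\<^sup>2))"
      using has_bochner_integral_integral_eq[OF fourier_transform_gaussian[OF True, of x]] by simp
    also have "\<dots> = complex_of_real (2 * (s powr ((\<kappa> - 1) / 2 - 1) * sqrt (pi * s)) * (exp (- s) * exp (- s * x\<^sup>2)))"
      by simp
    also have "exp (- s) * exp (- s * x\<^sup>2) = exp (- (1 + x\<^sup>2) * s ^ 1)"
      by (simp add: algebra_simps flip: exp_add)
    finally show ?thesis using True unfolding sqrt_gamma_exponent[OF True] by simp
  next
    case False
    then have "indicator {0<..} s = (0::real)" by (simp add: indicator_def)
    then show ?thesis by (simp only: gamma_gauss_def mult_zero_left mult_zero_right has_bochner_integral_zero of_real_0 Bochner_Integration.integral_zero)
  qed
  have "(LINT l|lborel. G * (exp (\<i> * complex_of_real (l * x)) * complex_of_real (spectral_kernel \<kappa> l))) =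
    (LINT s|lborel. complex_of_real (2 * sqrt pi * (indicator {0<..} s * (s powr (\<kappa> / 2 - 1) * exp (- (1 + x\<^sup>2) * s ^ 1)))))"
    using lborel_pair.Fubini_integral[OF int] unfolding inner inner' .
  also have "\<dots> = complex_of_real (2 * sqrt pi * (Gamma ((\<kappa> / 2 - 1 + 1) / real 1) / (real 1 * (1 + x\<^sup>2) powr ((\<kappa> / 2 - 1 + 1) / real 1))))"
    using has_bochner_integral_powr_exp[of "\<kappa> / 2 - 1" "1 + x\<^sup>2" 1] assms
    by (subst integral_complex_of_real, subst integral_mult_right_zero, subst has_bochner_integral_integral_eq)
       (auto simp: add_pos_nonneg)
  also have "\<dots> = G * complex_of_real (1 / (1 + x\<^sup>2) powr (\<kappa> / 2))"
    by (simp add: G_def)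
  finally have eq: "(LINT l|lborel. G * (exp (\<i> * complex_of_real (l * x)) * complex_of_real (spectral_kernel \<kappa> l))) =
     G * complex_of_real (1 / (1 + x\<^sup>2) powr (\<kappa> / 2))" .
  have int': "integrable lborel (\<lambda>l. G * (exp (\<i> * complex_of_real (l * x)) * complex_of_real (spectral_kernel \<kappa> l)))"
    using lborel_pair.integrable_snd[OF int] unfolding inner .
  from has_bochner_integral_mult_right[OF has_bochner_integral_integrable[OF int', unfolded eq], of "complex_of_real (1 / G)"]
  show ?thesis using G by (simp add: mult.assoc[symmetric])
qed

section \<open>Superposition of shifted kernels and uniqueness of the density\<close>

lemma fourier_transform_shift:
  fixes g :: "real \<Rightarrow> real"
  assumes "has_bochner_integral lborel (\<lambda>l. exp (\<i> * complex_of_real (l * x)) * complex_of_real (g l)) c"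
  shows "has_bochner_integral lborel (\<lambda>l. exp (\<i> * complex_of_real (l * x)) * complex_of_real (g (l + w)))
     (exp (- (\<i> * complex_of_real (w * x))) * c)"
proof -
  have "has_bochner_integral lborel (\<lambda>l. exp (\<i> * complex_of_real ((w + 1 * l) * x)) * complex_of_real (g (w + 1 * l))) c"
    using assms by (subst (asm) lborel_has_bochner_integral_real_affine_iff[where c = 1 and t = w]) simp_all
  from has_bochner_integral_mult_right[OF this, of "exp (- (\<i> * complex_of_real (w * x)))"]
  have "has_bochner_integral lborel (\<lambda>l. exp (- (\<i> * complex_of_real (w * x))) *
     (exp (\<i> * complex_of_real ((w + 1 * l) * x)) * complex_of_real (g (w + 1 * l)))) (exp (- (\<i> * complex_of_real (w * x))) * c)"
    by simp
  moreover have "exp (- (\<i> * complex_of_real (w * x))) *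
     (exp (\<i> * complex_of_real ((w + 1 * l) * x)) * complex_of_real (g (w + 1 * l))) =
     exp (\<i> * complex_of_real (l * x)) * complex_of_real (g (l + w))" for l
  proof -
    have "exp (- (\<i> * complex_of_real (w * x))) * exp (\<i> * complex_of_real ((w + 1 * l) * x)) = exp (\<i> * complex_of_real (l * x))"
      by (simp add: ring_distribs flip: exp_add)
    then show ?thesis by (simp add: mult.assoc[symmetric] add.commute)
  qed
  ultimately show ?thesis by simp
qed

text \<open>Translation by \<open>w j\<close> and by \<open>- w j\<close> modulates the Fourier
  transform with conjugate phases, whose mean is \<open>cos (w j * x)\<close>. Writing it with
  \<open>spectral_kernel\<close> in place of the Bessel formula makes all its properties follow from
  those of the mixture.\<close>

definition spectral_density :: "nat \<Rightarrow> (nat \<Rightarrow> real) \<Rightarrow> (nat \<Rightarrow> real) \<Rightarrow> (nat \<Rightarrow> real) \<Rightarrow> real \<Rightarrow> real" where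
  "spectral_density n A w \<kappa> l =
     (\<Sum>j\<le>n. A j / 2 * (spectral_kernel (\<kappa> j) (l + w j) + spectral_kernel (\<kappa> j) (l - w j)))"

lemma borel_measurable_spectral_density [measurable]: "spectral_density n A w \<kappa> \<in> borel_measurable borel"
  unfolding spectral_density_def[abs_def] by measurable

lemma fourier_transform_spectral_density:
  assumes "\<forall>j\<le>n. 0 < \<kappa> j"
  shows "has_bochner_integral lborel
    (\<lambda>l. exp (\<i> * complex_of_real (l * x)) * complex_of_real (spectral_density n A w \<kappa> l))
    (complex_of_real (\<Sum>j\<le>n. A j * cos (w j * x) / (1 + x\<^sup>2) powr (\<kappa> j / 2)))"
proof -
  define E where "E l = exp (\<i> * complex_of_real (l * x))" for l
  define c where "c j = complex_of_real (1 / (1 + x\<^sup>2) powr (\<kappa> j / 2))" for j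
  have "has_bochner_integral lborel
    (\<lambda>l. \<Sum>j\<le>n. complex_of_real (A j / 2) * (E l * complex_of_real (spectral_kernel (\<kappa> j) (l + w j)) +
         E l * complex_of_real (spectral_kernel (\<kappa> j) (l + - w j))))
    (\<Sum>j\<le>n. complex_of_real (A j / 2) * (exp (- (\<i> * complex_of_real (w j * x))) * c j
        + exp (- (\<i> * complex_of_real (- w j * x))) * c j))"
    using assms unfolding E_def c_def
    by (intro has_bochner_integral_sum has_bochner_integral_mult_right has_bochner_integral_add
         fourier_transform_shift fourier_transform_spectral_kernel) auto
  moreover have "(\<Sum>j\<le>n. complex_of_real (A j / 2) * (E l * complex_of_real (spectral_kernel (\<kappa> j) (l + w j)) +
         E l * complex_of_real (spectral_kernel (\<kappa> j) (l + - w j)))) = E l * complex_of_real (spectral_density n A w \<kappa> l)" for l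
    by (simp add: spectral_density_def sum_distrib_left algebra_simps)
  moreover have "complex_of_real (A j / 2) * (exp (- (\<i> * complex_of_real (w j * x))) * c j
        + exp (- (\<i> * complex_of_real (- w j * x))) * c j) =
        complex_of_real (A j * cos (w j * x) / (1 + x\<^sup>2) powr (\<kappa> j / 2))" for j
  proof -
    have "exp (- (\<i> * complex_of_real (w j * x))) + exp (- (\<i> * complex_of_real (- w j * x))) = complex_of_real (2 * cos (w j * x))"
      by (simp add: cos_of_real[symmetric] cos_exp_eq algebra_simps)
    then have "complex_of_real (A j / 2) * ((exp (- (\<i> * complex_of_real (w j * x)))
        + exp (- (\<i> * complex_of_real (- w j * x)))) * c j) = complex_of_real (A j / 2) * (complex_of_real (2 * cos (w j * x)) * c j)"
      by (simp only:)
    then show ?thesis by (simp only: distrib_right) (simp add: c_def)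
  qed
  ultimately show ?thesis by (simp add: E_def)
qed

text \<open>Total mass 1 turns both functions into probability densities, so that uniqueness of
  characteristic functions applies to the measures. The mass of \<open>g\<close> is not assumed: it
  is the value of the common transform at \<open>x = 0\<close>.\<close>

lemma fourier_transform_density_unique:
  fixes f g :: "real \<Rightarrow> real"
  assumes [measurable]: "f \<in> borel_measurable borel" "g \<in> borel_measurable borel"
    and nn: "\<And>l. 0 \<le> f l" "\<And>l. 0 \<le> g l"
    and int: "integrable lborel f" "integrable lborel g"
    and one: "(LINT l|lborel. f l) = 1"
    and eq: "\<And>x. (LINT l|lborel. exp (\<i> * complex_of_real (l * x)) * complex_of_real (f l)) =
                   (LINT l|lborel. exp (\<i> * complex_of_real (l * x)) * complex_of_real (g l))"
  shows "AE l in lborel. f l = g l"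
proof -
  have "complex_of_real (LINT l|lborel. f l) = complex_of_real (LINT l|lborel. g l)"
    using eq[of 0] by simp
  then have one': "(LINT l|lborel. g l) = 1" using one by simp
  have rd: "real_distribution (density lborel h)"
    if [measurable]: "h \<in> borel_measurable borel" and h: "\<And>l. 0 \<le> h l" "integrable lborel h" "(LINT l|lborel. h l) = 1"
    for h :: "real \<Rightarrow> real"
  proof -
    have "prob_space (density lborel h)"
      by (rule prob_spaceI) (use h nn_integral_eq_integral[OF h(2)] in \<open>simp add: emeasure_density\<close>)
    then show ?thesis by (simp add: real_distribution_def real_distribution_axioms_def)
  qed
  have ch: "char (density lborel h) x = (LINT l|lborel. exp (\<i> * complex_of_real (l * x)) * complex_of_real (h l))"
    if [measurable]: "h \<in> borel_measurable borel" and h: "\<And>l. 0 \<le> h l" for h :: "real \<Rightarrow> real" and x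
    unfolding char_def using h by (subst integral_density) (auto simp: scaleR_conv_of_real mult_ac)
  have "density lborel f = density lborel g"
    by (rule Levy_uniqueness) (auto intro!: rd nn int one one' simp: ch nn fun_eq_iff simp del: of_real_mult simp: eq)
  then have "AE l in lborel. ennreal (f l) = ennreal (g l)"
    by (subst (asm) sigma_finite_measure.density_unique_iff[OF sigma_finite_lborel]) auto
  then show ?thesis by eventually_elim (simp add: nn)
qed

lemma spectral_density_nonneg:
  "\<forall>j\<le>n. 0 \<le> A j \<Longrightarrow> \<forall>j\<le>n. 0 < \<kappa> j \<Longrightarrow> 0 \<le> spectral_density n A w \<kappa> l"
  unfolding spectral_density_def
  by (intro sum_nonneg mult_nonneg_nonneg add_nonneg_nonneg spectral_kernel_nonneg) auto

lemma spectral_kernel_minus: "spectral_kernel \<kappa> (- l) = spectral_kernel \<kappa> l"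
  by (simp add: spectral_kernel_def gamma_gauss_def)

lemma
  assumes "A 0 = 0" "\<forall>j\<in>{1..n}. w j \<noteq> 0" "\<forall>j\<le>n. 0 < \<kappa> j"
  shows isCont_spectral_density_0: "isCont (spectral_density n A w \<kappa>) 0"
    and spectral_density_0: "spectral_density n A w \<kappa> 0 = const_C n A w \<kappa>"
proof -
  have split: "(\<Sum>j\<le>n. F j) = (\<Sum>j=1..n. F j)" if "F 0 = 0" for F :: "nat \<Rightarrow> real"
    using that by (simp add: atMost_atLeast0 sum.atLeast_Suc_atMost)
  have eq: "spectral_density n A w \<kappa> = (\<lambda>l. (\<Sum>j=1..n. A j / 2 * (spectral_kernel (\<kappa> j) (l + w j) + spectral_kernel (\<kappa> j) (l - w j))))"
    unfolding spectral_density_def[abs_def] using assms by (subst split) auto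
  have comp: "isCont (\<lambda>l. spectral_kernel a (l + b)) 0" if "0 < a" "b \<noteq> 0" for a b :: real
    by (rule isCont_o2[where g = "spectral_kernel a" and f = "\<lambda>l. l + b"])
       (use that isCont_spectral_kernel[of a b] in \<open>auto intro!: continuous_intros\<close>)
  show "isCont (spectral_density n A w \<kappa>) 0"
    unfolding eq diff_conv_add_uminus
    using assms by (intro continuous_intros comp) auto
  \<comment> \<open>The kernel is even, so the two translates agree at 0 and their sum cancels the
    factor one half.\<close>
  have "A j / 2 * (spectral_kernel (\<kappa> j) (0 + w j) + spectral_kernel (\<kappa> j) (0 - w j)) =
     c1 (\<kappa> j) * A j * bessel_K ((\<kappa> j - 1) / 2) \<bar>w j\<bar> * \<bar>w j\<bar> powr ((\<kappa> j - 1) / 2)"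
    if "j \<in> {1..n}" for j
    using that assms by (simp add: spectral_kernel_minus spectral_kernel_bessel_K)
  then show "spectral_density n A w \<kappa> 0 = const_C n A w \<kappa>"
    unfolding eq const_C_def by (intro sum.cong) auto
qed

subsection \<open>Characteristic functions determine laws of random vectors\<close>

lemma lborel_integral_affine:
  fixes F :: "'b::euclidean_space \<Rightarrow> real" and \<sigma> :: real
  assumes [measurable]: "F \<in> borel_measurable borel" and "\<sigma> > 0"
  shows "(LINT y|lborel. F y) = \<sigma> ^ DIM('b) * (LINT z|lborel. F (x + \<sigma> *\<^sub>R z))"
    and "integrable lborel F \<longleftrightarrow> integrable lborel (\<lambda>z. F (x + \<sigma> *\<^sub>R z))"
proof -
  have eq: "lborel = density (distr lborel borel (\<lambda>z::'b. x + \<sigma> *\<^sub>R z)) (\<lambda>_. ennreal (\<sigma> ^ DIM('b)))"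
    using lborel_affine[of \<sigma> x] assms by simp
  show "(LINT y|lborel. F y) = \<sigma> ^ DIM('b) * (LINT z|lborel. F (x + \<sigma> *\<^sub>R z))"
    using assms by (subst eq, subst integral_density) (auto simp: integral_distr)
  show "integrable lborel F \<longleftrightarrow> integrable lborel (\<lambda>z. F (x + \<sigma> *\<^sub>R z))"
    using assms by (subst eq, subst integrable_density) (auto simp: integrable_distr_eq)
qed

lemma norm_square_Basis: "(norm (v::'b::euclidean_space))\<^sup>2 = (\<Sum>b\<in>Basis. (v \<bullet> b)\<^sup>2)"
  unfolding power2_norm_eq_inner by (subst euclidean_inner) (simp add: power2_eq_square)

lemma has_bochner_integral_gaussian_euclidean:
  "has_bochner_integral lborel (\<lambda>z::'b::euclidean_space. exp (- (norm z)\<^sup>2 / 2)) (sqrt (2 * pi) ^ DIM('b))"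
proof (rule has_bochner_integral_nn_integral)
  have g: "has_bochner_integral lborel (\<lambda>x::real. exp (- (x\<^sup>2 / 2))) (sqrt (2 * pi))"
  proof -
    have "2 * sqrt (pi * (1 / 2)) = sqrt 4 * sqrt (pi * (1 / 2))" by simp
    also have "\<dots> = sqrt (2 * pi)" unfolding real_sqrt_mult[symmetric] by simp
    finally show ?thesis using has_bochner_integral_gaussian[of "1 / 2"] by simp
  qed
  have "(\<integral>\<^sup>+z. ennreal (exp (- (norm (z::'b))\<^sup>2 / 2)) \<partial>lborel) =
     (\<integral>\<^sup>+z. (\<Prod>b\<in>Basis. ennreal (exp (- (((z::'b) \<bullet> b)\<^sup>2 / 2)))) \<partial>lborel)"
    by (simp add: norm_square_Basis prod_ennreal sum_divide_distrib sum_negf flip: exp_sum)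
  also have "\<dots> = (\<Prod>b\<in>(Basis::'b set). (\<integral>\<^sup>+x. ennreal (exp (- (x\<^sup>2 / 2))) \<partial>lborel))"
    by (rule nn_integral_lborel_prod) auto
  also have "(\<integral>\<^sup>+x. ennreal (exp (- (x\<^sup>2 / 2))) \<partial>lborel) = ennreal (sqrt (2 * pi))"
    using g by (subst nn_integral_eq_integral) (auto simp: has_bochner_integral_iff)
  finally show "(\<integral>\<^sup>+z. ennreal (exp (- (norm (z::'b))\<^sup>2 / 2)) \<partial>lborel) = ennreal (sqrt (2 * pi) ^ DIM('b))"
    by (simp add: ennreal_power)
qed auto

text \<open>A law on coordinate families over \<open>Basis\<close>, not on the space itself:
  independence of the coordinates is built in and product integrals factor. The map
  \<open>\<Sum>b\<in>Basis. z b *\<^sub>R b\<close> carries it to a standard normal vector.\<close>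

definition std_normal_coords :: "('b::euclidean_space \<Rightarrow> real) measure" where
  "std_normal_coords = PiM Basis (\<lambda>_. std_normal_distribution)"

interpretation std_normal_coords: prob_space "std_normal_coords :: ('b::euclidean_space \<Rightarrow> real) measure"
  unfolding std_normal_coords_def by (intro prob_space_PiM prob_space_normal_density) auto

lemma measurable_std_normal_coords [measurable]:
  "(\<lambda>z. \<Sum>b\<in>Basis. z b *\<^sub>R (b::'b::euclidean_space)) \<in> borel_measurable std_normal_coords"
proof -
  have "(\<lambda>z. z b) \<in> borel_measurable std_normal_coords" if "b \<in> Basis" for b :: 'b
    using measurable_component_singleton[OF that, of "\<lambda>_. std_normal_distribution"]
    by (simp add: std_normal_coords_def cong: measurable_cong_sets)
  then show ?thesis by (intro borel_measurable_sum borel_measurable_scaleR) auto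
qed

lemma char_std_normal_coords:
  fixes v :: "'b::euclidean_space"
  shows "(CLINT z|std_normal_coords. iexp ((\<Sum>b\<in>Basis. z b *\<^sub>R b) \<bullet> v)) = complex_of_real (exp (- (norm v)\<^sup>2 / 2))"
proof -
  interpret product_sigma_finite "\<lambda>_::'b. std_normal_distribution"
    by (intro product_sigma_finite.intro prob_space_imp_sigma_finite prob_space_normal_density) auto
  have "(CLINT z|std_normal_coords. iexp ((\<Sum>b\<in>Basis. z b *\<^sub>R b) \<bullet> v)) =
     (CLINT z|PiM Basis (\<lambda>_::'b. std_normal_distribution). (\<Prod>b\<in>Basis. iexp ((v \<bullet> b) * z b)))"
    unfolding std_normal_coords_def
  proof (intro Bochner_Integration.integral_cong refl)
    fix z :: "'b \<Rightarrow> real"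
    have "(\<Sum>b\<in>Basis. z b *\<^sub>R b) \<bullet> v = (\<Sum>b\<in>Basis. (v \<bullet> b) * z b)"
      by (simp add: inner_sum_left inner_commute[of v] mult.commute)
    then show "iexp ((\<Sum>b\<in>Basis. z b *\<^sub>R b) \<bullet> v) = (\<Prod>b\<in>Basis. iexp ((v \<bullet> b) * z b))"
      by (simp add: sum_distrib_left exp_sum)
  qed
  also have "\<dots> = (\<Prod>b\<in>(Basis::'b set). CLINT x|std_normal_distribution. iexp ((v \<bullet> b) * x))"
  proof (rule product_integral_prod)
    interpret std: prob_space std_normal_distribution by (intro prob_space_normal_density) auto
    show "complex_integrable std_normal_distribution (\<lambda>x. iexp ((v \<bullet> b) * x))" for b
      by (rule std.integrable_const_bound[of _ 1]) auto
  qed auto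
  also have "\<dots> = (\<Prod>b\<in>(Basis::'b set). complex_of_real (exp (- (v \<bullet> b)\<^sup>2 / 2)))"
    using char_std_normal_distribution by (simp add: char_def fun_eq_iff)
  also have "\<dots> = complex_of_real (exp (- (norm v)\<^sup>2 / 2))"
    by (simp add: norm_square_Basis sum_divide_distrib sum_negf flip: exp_sum of_real_prod)
  finally show ?thesis .
qed

context prob_space
begin

text \<open>The Gaussian kernel is itself the characteristic function of a standard normal vector, so its
  expectation is an average of values of the characteristic function of \<open>X\<close>.\<close>

lemma expectation_gaussian_kernel:
  fixes X :: "'a \<Rightarrow> 'b::euclidean_space"
  assumes [measurable]: "X \<in> borel_measurable M"
  shows "complex_of_real (expectation (\<lambda>\<omega>. exp (- (norm ((y - X \<omega>) /\<^sub>R \<sigma>))\<^sup>2 / 2))) =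
    (CLINT z|std_normal_coords. iexp ((\<Sum>b\<in>Basis. z b *\<^sub>R b) \<bullet> (y /\<^sub>R \<sigma>)) *
        (CLINT \<omega>|M. iexp (((- 1 / \<sigma>) *\<^sub>R (\<Sum>b\<in>Basis. z b *\<^sub>R b)) \<bullet> X \<omega>)))"
proof -
  interpret Q: pair_prob_space M "std_normal_coords :: ('b \<Rightarrow> real) measure" ..
  define U where "U z = (\<Sum>b\<in>Basis. z b *\<^sub>R (b::'b))" for z
  have [measurable]: "U \<in> borel_measurable std_normal_coords"
    unfolding U_def[abs_def] by measurable
  have "complex_of_real (expectation (\<lambda>\<omega>. exp (- (norm ((y - X \<omega>) /\<^sub>R \<sigma>))\<^sup>2 / 2))) =
     (CLINT \<omega>|M. complex_of_real (exp (- (norm ((y - X \<omega>) /\<^sub>R \<sigma>))\<^sup>2 / 2)))"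
    by (rule integral_complex_of_real[symmetric])
  also have "\<dots> = (CLINT \<omega>|M. CLINT z|std_normal_coords. iexp (U z \<bullet> ((y - X \<omega>) /\<^sub>R \<sigma>)))"
    by (simp only: char_std_normal_coords U_def)
  also have "\<dots> = (CLINT z|std_normal_coords. CLINT \<omega>|M. iexp (U z \<bullet> ((y - X \<omega>) /\<^sub>R \<sigma>)))"
    by (rule Q.Fubini_integral[symmetric]) (rule Q.integrable_const_bound[of _ 1], auto)
  also have "\<dots> = (CLINT z|std_normal_coords. iexp (U z \<bullet> (y /\<^sub>R \<sigma>)) * (CLINT \<omega>|M. iexp (((- 1 / \<sigma>) *\<^sub>R U z) \<bullet> X \<omega>)))"
    by (subst integral_mult_right_zero[symmetric])
       (simp add: inner_diff_right right_diff_distrib divide_inverse flip: exp_add)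
  finally show ?thesis unfolding U_def .
qed

text \<open>The change of variables \<open>y = X \<omega> + \<sigma> *\<^sub>R z\<close> moves
  \<open>X\<close> out of the arbitrary \<open>h\<close> and into the Gaussian kernel, with Jacobian
  \<open>\<sigma> ^ DIM('b)\<close>. On the right, \<open>X\<close> enters only through an
  expectation fixed by its characteristic function.\<close>

lemma expectation_gaussian_smoothing:
  fixes X :: "'a \<Rightarrow> 'b::euclidean_space" and h :: "'b \<Rightarrow> real"
  assumes [measurable]: "X \<in> borel_measurable M" "h \<in> borel_measurable borel"
    and B: "\<And>x. \<bar>h x\<bar> \<le> B" and \<sigma>: "\<sigma> > 0"
  shows "\<sigma> ^ DIM('b) * expectation (\<lambda>\<omega>. LINT z|lborel. h (X \<omega> + \<sigma> *\<^sub>R z) * exp (- (norm z)\<^sup>2 / 2)) =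
    (LINT y|lborel. h y * expectation (\<lambda>\<omega>. exp (- (norm ((y - X \<omega>) /\<^sub>R \<sigma>))\<^sup>2 / 2)))"
proof -
  interpret Q: pair_sigma_finite M "lborel :: 'b measure" ..
  define w where "w z = exp (- (norm (z::'b))\<^sup>2 / 2)" for z
  have [measurable]: "w \<in> borel_measurable borel" unfolding w_def[abs_def] by measurable
  have w: "integrable lborel w"
    using has_bochner_integral_gaussian_euclidean by (auto simp: has_bochner_integral_iff w_def[abs_def])
  have wpos: "w z > 0" for z by (simp add: w_def)
  have int1: "integrable lborel (\<lambda>y. w ((y - x) /\<^sub>R \<sigma>))" for x
    using w \<sigma> by (subst lborel_integral_affine(2)[OF _ \<sigma>, of _ x]) auto
  \<comment> \<open>By translation invariance the inner integral is the same for every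
    \<open>\<omega>\<close>, and a constant is integrable over a probability space.\<close>
  have ker: "integrable (M \<Otimes>\<^sub>M lborel) (\<lambda>(\<omega>, y). w ((y - X \<omega>) /\<^sub>R \<sigma>))"
  proof (rule Q.Fubini_integrable)
    have "(LINT y|lborel. norm (case (\<omega>, y) of (\<omega>, y) \<Rightarrow> w ((y - X \<omega>) /\<^sub>R \<sigma>))) = \<sigma> ^ DIM('b) * (LINT z|lborel. w z)" for \<omega>
      using wpos \<sigma> by (subst lborel_integral_affine(1)[OF _ \<sigma>, of _ "X \<omega>"]) (auto simp: less_imp_le)
    then show "integrable M (\<lambda>\<omega>. LINT y|lborel. norm (case (\<omega>, y) of (\<omega>, y) \<Rightarrow> w ((y - X \<omega>) /\<^sub>R \<sigma>)))" by simp
  qed (use int1 in auto)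
  have B': "\<bar>h y\<bar> \<le> \<bar>B\<bar>" for y using B[of y] by linarith
  have int: "integrable (M \<Otimes>\<^sub>M lborel) (\<lambda>(\<omega>, y). h y * w ((y - X \<omega>) /\<^sub>R \<sigma>))"
    by (intro Bochner_Integration.integrable_bound[OF integrable_mult_right[OF ker, of B]])
       (auto simp: abs_mult split_beta intro!: AE_I2 mult_right_mono B')
  have "\<sigma> ^ DIM('b) * expectation (\<lambda>\<omega>. LINT z|lborel. h (X \<omega> + \<sigma> *\<^sub>R z) * w z) =
     expectation (\<lambda>\<omega>. \<sigma> ^ DIM('b) * (LINT z|lborel. h (X \<omega> + \<sigma> *\<^sub>R z) * w z))"
    by simp
  also have "\<dots> = expectation (\<lambda>\<omega>. LINT y|lborel. h y * w ((y - X \<omega>) /\<^sub>R \<sigma>))"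
  proof (intro Bochner_Integration.integral_cong refl)
    fix \<omega>
    show "\<sigma> ^ DIM('b) * (LINT z|lborel. h (X \<omega> + \<sigma> *\<^sub>R z) * w z) = (LINT y|lborel. h y * w ((y - X \<omega>) /\<^sub>R \<sigma>))"
      using \<sigma> by (subst lborel_integral_affine(1)[OF _ \<sigma>, of "\<lambda>y. h y * w ((y - X \<omega>) /\<^sub>R \<sigma>)" "X \<omega>"]) auto
  qed
  also have "\<dots> = (LINT y|lborel. expectation (\<lambda>\<omega>. h y * w ((y - X \<omega>) /\<^sub>R \<sigma>)))"
    by (rule Q.Fubini_integral[OF int, symmetric])
  finally show ?thesis by (simp add: w_def)
qed

lemma gaussian_smoothing_tendsto:
  fixes X :: "'a \<Rightarrow> 'b::euclidean_space" and h :: "'b \<Rightarrow> real"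
  assumes [measurable]: "X \<in> borel_measurable M" and h: "continuous_on UNIV h"
    and B: "\<And>x. \<bar>h x\<bar> \<le> B"
  shows "(\<lambda>n. expectation (\<lambda>\<omega>. LINT z|lborel. h (X \<omega> + (1 / Suc n) *\<^sub>R z) * exp (- (norm z)\<^sup>2 / 2)))
    \<longlonglongrightarrow> expectation (\<lambda>\<omega>. h (X \<omega>)) * sqrt (2 * pi) ^ DIM('b)"
proof -
  define w where "w z = exp (- (norm (z::'b))\<^sup>2 / 2)" for z
  have [measurable]: "h \<in> borel_measurable borel" by (rule borel_measurable_continuous_onI[OF h])
  have [measurable]: "w \<in> borel_measurable borel" unfolding w_def[abs_def] by measurable
  have wb: "has_bochner_integral lborel w (sqrt (2 * pi) ^ DIM('b))"
    using has_bochner_integral_gaussian_euclidean by (auto simp: w_def[abs_def])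
  then have w: "integrable lborel w" by (simp add: has_bochner_integral_iff)
  have wpos: "w z \<ge> 0" for z by (simp add: w_def)
  have bound: "norm (h x * w z) \<le> B * w z" for x z
    using B wpos by (simp add: abs_mult mult_right_mono)
  have ptw: "(\<lambda>n. LINT z|lborel. h (X \<omega> + (1 / Suc n) *\<^sub>R z) * w z) \<longlonglongrightarrow> (LINT z|lborel. h (X \<omega>) * w z)" for \<omega>
  proof (rule integral_dominated_convergence[where w = "\<lambda>z. B * w z"])
    show "AE z in lborel. (\<lambda>n. h (X \<omega> + (1 / Suc n) *\<^sub>R z) * w z) \<longlonglongrightarrow> h (X \<omega>) * w z"
    proof (intro AE_I2 tendsto_mult tendsto_const)
      fix z
      have "(\<lambda>n. X \<omega> + (1 / real (Suc n)) *\<^sub>R z) \<longlonglongrightarrow> X \<omega> + 0 *\<^sub>R z"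
        by (intro tendsto_intros LIMSEQ_Suc lim_1_over_n)
      moreover have "isCont h (X \<omega>)" using h by (simp add: continuous_on_eq_continuous_at)
      ultimately show "(\<lambda>n. h (X \<omega> + (1 / real (Suc n)) *\<^sub>R z)) \<longlonglongrightarrow> h (X \<omega>)"
        by (auto intro: isCont_tendsto_compose)
    qed
  qed (use w bound in auto)
  have "(\<lambda>n. expectation (\<lambda>\<omega>. LINT z|lborel. h (X \<omega> + (1 / Suc n) *\<^sub>R z) * w z)) \<longlonglongrightarrow>
     expectation (\<lambda>\<omega>. LINT z|lborel. h (X \<omega>) * w z)"
  proof (rule integral_dominated_convergence[where w = "\<lambda>_. LINT z|lborel. B * w z"])
    show "AE \<omega> in M. norm (LINT z|lborel. h (X \<omega> + (1 / Suc n) *\<^sub>R z) * w z) \<le> (LINT z|lborel. B * w z)" for n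
    proof (intro AE_I2)
      fix \<omega>
      have i: "integrable lborel (\<lambda>z. h (X \<omega> + (1 / Suc n) *\<^sub>R z) * w z)"
        by (rule Bochner_Integration.integrable_bound[of _ "\<lambda>z. B * w z"]) (use w bound order.trans[OF bound abs_ge_self] in auto)
      show "norm (LINT z|lborel. h (X \<omega> + (1 / Suc n) *\<^sub>R z) * w z) \<le> (LINT z|lborel. B * w z)"
        by (rule order.trans[OF integral_norm_bound integral_mono]) (use w i bound in auto)
    qed
  qed (use ptw in auto)
  then show ?thesis using has_bochner_integral_integral_eq[OF wb] unfolding w_def[symmetric] by simp
qed

text \<open>Smoothing \<open>h\<close> by a Gaussian of width \<open>1 / Suc n\<close> gives
  expectations that only see the characteristic function; as the width shrinks, continuity and
  boundedness of \<open>h\<close> recover the plain expectations. The unnormalised Gaussian leaves a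
  common factor \<open>sqrt (2 * pi) ^ DIM('b)\<close>, which cancels.\<close>

theorem expectation_eq_of_char_eq:
  fixes X Y :: "'a \<Rightarrow> 'b::euclidean_space" and h :: "'b \<Rightarrow> real"
  assumes X: "X \<in> borel_measurable M" and Y: "Y \<in> borel_measurable M"
    and char: "\<And>u. (CLINT \<omega>|M. iexp (u \<bullet> X \<omega>)) = (CLINT \<omega>|M. iexp (u \<bullet> Y \<omega>))"
    and h: "continuous_on UNIV h" "bounded (range h)"
  shows "expectation (\<lambda>\<omega>. h (X \<omega>)) = expectation (\<lambda>\<omega>. h (Y \<omega>))"
proof -
  obtain B where B: "\<And>x. \<bar>h x\<bar> \<le> B" using h(2) by (auto simp: bounded_iff)
  have hm: "h \<in> borel_measurable borel" by (rule borel_measurable_continuous_onI[OF h(1)])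
  have kernel: "expectation (\<lambda>\<omega>. exp (- (norm ((y - X \<omega>) /\<^sub>R \<sigma>))\<^sup>2 / 2)) =
      expectation (\<lambda>\<omega>. exp (- (norm ((y - Y \<omega>) /\<^sub>R \<sigma>))\<^sup>2 / 2))" for y \<sigma>
  proof -
    have "complex_of_real (expectation (\<lambda>\<omega>. exp (- (norm ((y - X \<omega>) /\<^sub>R \<sigma>))\<^sup>2 / 2))) =
      complex_of_real (expectation (\<lambda>\<omega>. exp (- (norm ((y - Y \<omega>) /\<^sub>R \<sigma>))\<^sup>2 / 2)))"
      unfolding expectation_gaussian_kernel[OF X] expectation_gaussian_kernel[OF Y] char ..
    then show ?thesis by (simp only: of_real_eq_iff)
  qed
  have "expectation (\<lambda>\<omega>. LINT z|lborel. h (X \<omega> + (1 / Suc n) *\<^sub>R z) * exp (- (norm z)\<^sup>2 / 2)) =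
     expectation (\<lambda>\<omega>. LINT z|lborel. h (Y \<omega> + (1 / Suc n) *\<^sub>R z) * exp (- (norm z)\<^sup>2 / 2))" for n
  proof -
    have pos: "1 / real (Suc n) > 0" by simp
    have "(1 / Suc n) ^ DIM('b) * expectation (\<lambda>\<omega>. LINT z|lborel. h (X \<omega> + (1 / Suc n) *\<^sub>R z) * exp (- (norm z)\<^sup>2 / 2)) =
     (1 / Suc n) ^ DIM('b) * expectation (\<lambda>\<omega>. LINT z|lborel. h (Y \<omega> + (1 / Suc n) *\<^sub>R z) * exp (- (norm z)\<^sup>2 / 2))"
      by (simp only: expectation_gaussian_smoothing[OF X hm B pos] expectation_gaussian_smoothing[OF Y hm B pos] kernel)
    then show ?thesis by (subst (asm) mult_cancel_left) auto
  qed
  then have "expectation (\<lambda>\<omega>. h (X \<omega>)) * sqrt (2 * pi) ^ DIM('b) = expectation (\<lambda>\<omega>. h (Y \<omega>)) * sqrt (2 * pi) ^ DIM('b)"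
    using LIMSEQ_unique[OF gaussian_smoothing_tendsto[OF X h(1) B]] gaussian_smoothing_tendsto[OF Y h(1) B]
    by simp
  then show ?thesis by simp
qed

end

subsection \<open>White noise integrals\<close>

text \<open>The value at argument 1 suffices, since coefficients are later absorbed into the
  integrand. In the degenerate case the zero mean forces the constant to be 0, so that
  \<open>v = 0\<close> and the formula persists.\<close>

lemma (in prob_space) gaussian_rv_char:
  assumes Y: "gaussian_rv M Y" and mean: "expectation Y = 0"
    and var: "expectation (\<lambda>\<omega>. (Y \<omega>)\<^sup>2) = v"
  shows "(CLINT \<omega>|M. iexp (Y \<omega>)) = complex_of_real (exp (- v / 2))"
proof -
  have [measurable]: "Y \<in> borel_measurable M" using Y by (simp add: gaussian_rv_def)
  from Y consider (normal) \<mu> \<sigma> where "0 < \<sigma>" "distributed M lborel Y (normal_density \<mu> \<sigma>)"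
    | (const) c where "AE \<omega> in M. Y \<omega> = c"
    unfolding gaussian_rv_def by blast
  then show ?thesis
  proof cases
    case normal
    have \<mu>: "\<mu> = 0" using normal_distributed_expectation[OF normal] mean by simp
    have v: "v = \<sigma>\<^sup>2" using normal_distributed_variance[OF normal] mean var by simp
    have D: "distributed M lborel (\<lambda>\<omega>. Y \<omega> / \<sigma>) std_normal_density"
      using normal(2) unfolding normal_standard_normal_convert[OF normal(1)] \<mu> by simp
    have "(CLINT \<omega>|M. iexp (Y \<omega>)) = (CLINT \<omega>|M. iexp (\<sigma> * (Y \<omega> / \<sigma>)))"
      using normal(1) by simp
    also have "\<dots> = (CLINT z|distr M lborel (\<lambda>\<omega>. Y \<omega> / \<sigma>). iexp (\<sigma> * z))"
      by (subst integral_distr) auto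
    also have "distr M lborel (\<lambda>\<omega>. Y \<omega> / \<sigma>) = std_normal_distribution"
      using D by (simp add: distributed_def)
    also have "(CLINT z|std_normal_distribution. iexp (\<sigma> * z)) = complex_of_real (exp (- \<sigma>\<^sup>2 / 2))"
      using fun_cong[OF char_std_normal_distribution, of \<sigma>] by (simp add: char_def)
    finally show ?thesis by (simp add: v)
  next
    case const
    have "expectation Y = expectation (\<lambda>_. c)" using const by (intro integral_cong_AE) auto
    then have c: "c = 0" using mean by (simp add: prob_space)
    have "v = expectation (\<lambda>_. 0)" unfolding var[symmetric] using const c by (intro integral_cong_AE) auto
    moreover have "(CLINT \<omega>|M. iexp (Y \<omega>)) = (CLINT \<omega>|M. 1)"
      using const c by (intro integral_cong_AE) auto
    ultimately show ?thesis by (simp add: prob_space)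
  qed
qed

lemma sq_int_measurable: "sq_int g \<Longrightarrow> g \<in> borel_measurable borel"
  by (simp add: sq_int_def)

lemma sq_int_add:
  assumes "sq_int g" "sq_int h"
  shows "sq_int (\<lambda>l. a * g l + b * h l)"
  unfolding sq_int_def
proof
  have [measurable]: "g \<in> borel_measurable borel" "h \<in> borel_measurable borel"
    using assms by (auto simp: sq_int_def)
  show "(\<lambda>l. a * g l + b * h l) \<in> borel_measurable lborel" by measurable
  show "integrable lborel (\<lambda>l. (cmod (a * g l + b * h l))\<^sup>2)"
  proof (rule Bochner_Integration.integrable_bound)
    show "integrable lborel (\<lambda>l. 2 * (cmod a)\<^sup>2 * (cmod (g l))\<^sup>2 + 2 * (cmod b)\<^sup>2 * (cmod (h l))\<^sup>2)"
      using assms by (auto simp: sq_int_def)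
    have "(cmod (a * g l + b * h l))\<^sup>2 \<le> 2 * (cmod a)\<^sup>2 * (cmod (g l))\<^sup>2 + 2 * (cmod b)\<^sup>2 * (cmod (h l))\<^sup>2" for l
    proof -
      have "(cmod (a * g l + b * h l))\<^sup>2 \<le> (cmod (a * g l) + cmod (b * h l))\<^sup>2"
        by (intro power_mono norm_triangle_ineq) auto
      also have "\<dots> \<le> 2 * (cmod (a * g l))\<^sup>2 + 2 * (cmod (b * h l))\<^sup>2"
        using sum_squares_bound[of "cmod (a * g l)" "cmod (b * h l)"] by (simp add: power2_sum)
      finally show ?thesis by (simp add: norm_mult power_mult_distrib mult_ac)
    qed
    then show "AE l in lborel. norm ((cmod (a * g l + b * h l))\<^sup>2) \<le>
        norm (2 * (cmod a)\<^sup>2 * (cmod (g l))\<^sup>2 + 2 * (cmod b)\<^sup>2 * (cmod (h l))\<^sup>2)"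
      by auto
  qed measurable
qed

lemma sq_int_zero: "sq_int (\<lambda>_. 0)"
  by (simp add: sq_int_def)

lemma sq_int_sum:
  assumes "finite S" "\<And>i. i \<in> S \<Longrightarrow> sq_int (g i)"
  shows "sq_int (\<lambda>l. \<Sum>i\<in>S. u i * g i l)"
  using assms
proof (induction S rule: finite_induct)
  case (insert i S)
  have "sq_int (\<lambda>l. u i * g i l + 1 * (\<Sum>i\<in>S. u i * g i l))"
    using insert by (intro sq_int_add) auto
  then show ?case using insert by simp
qed (simp add: sq_int_zero)

lemma sq_int_cnj_reflect:
  assumes "sq_int g"
  shows "sq_int (\<lambda>l. cnj (g (- l)))"
proof -
  have [measurable]: "g \<in> borel_measurable borel" using assms by (auto simp: sq_int_def)
  have [measurable]: "cnj \<in> borel_measurable borel"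
    by (intro borel_measurable_continuous_onI continuous_intros)
  have "(\<lambda>l. cnj (g (- l))) \<in> borel_measurable lborel" by measurable
  moreover have "integrable lborel (\<lambda>l. (cmod (g (0 + -1 * l)))\<^sup>2)"
    using assms lborel_integrable_real_affine[of "\<lambda>l. (cmod (g l))\<^sup>2" "-1" 0] by (simp add: sq_int_def)
  ultimately show ?thesis by (simp add: sq_int_def)
qed

text \<open>The projection onto integrands with \<open>g (- l) = cnj (g l)\<close>, which are those
  with real stochastic integral. Under \<open>I\<close> it corresponds to taking the real
  part.\<close>

definition sym_part :: "(real \<Rightarrow> complex) \<Rightarrow> real \<Rightarrow> complex" where
  "sym_part g l = (g l + cnj (g (- l))) / 2"

lemma sq_int_sym_part: "sq_int g \<Longrightarrow> sq_int (sym_part g)"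
  using sq_int_add[OF _ sq_int_cnj_reflect, of g g "1 / 2" "1 / 2"]
  unfolding sym_part_def by (simp add: add_divide_distrib)

locale white_noise = prob_space P for P :: "'a measure" +
  fixes I :: "(real \<Rightarrow> complex) \<Rightarrow> 'a \<Rightarrow> complex"
  assumes wn: "white_noise_integral P I"
begin

lemma I_measurable: "sq_int g \<Longrightarrow> I g \<in> borel_measurable P"
  using wn unfolding white_noise_integral_def by blast

lemma I_add: "sq_int g \<Longrightarrow> sq_int h \<Longrightarrow>
    AE \<omega> in P. I (\<lambda>l. a * g l + b * h l) \<omega> = a * I g \<omega> + b * I h \<omega>"
  using wn unfolding white_noise_integral_def by blast

lemma I_cnj: "sq_int g \<Longrightarrow> AE \<omega> in P. I (\<lambda>l. cnj (g (- l))) \<omega> = cnj (I g \<omega>)"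
  using wn unfolding white_noise_integral_def by blast

lemma I_integrable: "sq_int g \<Longrightarrow> integrable P (I g)"
  and I_mean: "sq_int g \<Longrightarrow> (LINT \<omega>|P. I g \<omega>) = 0"
  using wn unfolding white_noise_integral_def by blast+

lemma I_prod_integrable: "sq_int g \<Longrightarrow> sq_int h \<Longrightarrow> integrable P (\<lambda>\<omega>. I g \<omega> * cnj (I h \<omega>))"
  and I_isometry: "sq_int g \<Longrightarrow> sq_int h \<Longrightarrow>
    (LINT \<omega>|P. I g \<omega> * cnj (I h \<omega>)) = (LINT l|lborel. g l * cnj (h l))"
  using wn unfolding white_noise_integral_def by blast+

lemma gaussian_rv_Re_I:
  assumes "sq_int g"
  shows "gaussian_rv P (\<lambda>\<omega>. Re (I g \<omega>))"
proof -
  have "\<forall>(gs :: nat \<Rightarrow> real \<Rightarrow> complex) N. (\<forall>i<N. sq_int (gs i)) \<longrightarrow>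
        gaussian_rv P (\<lambda>\<omega>. \<Sum>i<N. Re (I (gs i) \<omega>))"
    using wn unfolding white_noise_integral_def by blast
  from this[rule_format, of 1 "\<lambda>_. g"] assms show ?thesis by simp
qed

lemma I_sum:
  assumes "finite S" "\<And>i. i \<in> S \<Longrightarrow> sq_int (g i)"
  shows "AE \<omega> in P. I (\<lambda>l. \<Sum>i\<in>S. u i * g i l) \<omega> = (\<Sum>i\<in>S. u i * I (g i) \<omega>)"
  using assms
proof (induction S rule: finite_induct)
  case empty
  show ?case using I_add[OF sq_int_zero sq_int_zero, of 0 0] by simp
next
  case (insert i S)
  have "AE \<omega> in P. I (\<lambda>l. u i * g i l + 1 * (\<Sum>i\<in>S. u i * g i l)) \<omega> = u i * I (g i) \<omega> + 1 * I (\<lambda>l. \<Sum>i\<in>S. u i * g i l) \<omega>"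
    using insert by (intro I_add sq_int_sum) auto
  moreover have "AE \<omega> in P. I (\<lambda>l. \<Sum>i\<in>S. u i * g i l) \<omega> = (\<Sum>i\<in>S. u i * I (g i) \<omega>)"
    using insert by auto
  ultimately show ?case by eventually_elim (use insert in simp)
qed

lemma norm_I_square:
  assumes "sq_int g"
  shows "integrable P (\<lambda>\<omega>. (cmod (I g \<omega>))\<^sup>2)"
    and "(LINT \<omega>|P. (cmod (I g \<omega>))\<^sup>2) = (LINT l|lborel. (cmod (g l))\<^sup>2)"
proof -
  have eq: "(cmod z)\<^sup>2 = Re (z * cnj z)" for z by (simp add: complex_mult_cnj cmod_def)
  show "integrable P (\<lambda>\<omega>. (cmod (I g \<omega>))\<^sup>2)"
    unfolding eq by (intro integrable_Re I_prod_integrable assms)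
  have "integrable lborel (\<lambda>l. complex_of_real ((cmod (g l))\<^sup>2))"
    using assms by (intro integrable_of_real) (simp add: sq_int_def)
  then have "integrable lborel (\<lambda>l. g l * cnj (g l))" by (simp only: complex_norm_square)
  then show "(LINT \<omega>|P. (cmod (I g \<omega>))\<^sup>2) = (LINT l|lborel. (cmod (g l))\<^sup>2)"
    using I_prod_integrable[OF assms assms] I_isometry[OF assms assms] by (simp only: eq integral_Re)
qed

lemma Re_I:
  assumes "sq_int g"
  shows "AE \<omega> in P. I (sym_part g) \<omega> = complex_of_real (Re (I g \<omega>))"
proof -
  have "sym_part g = (\<lambda>l. 1 / 2 * g l + 1 / 2 * cnj (g (- l)))"
    by (simp add: sym_part_def fun_eq_iff add_divide_distrib)
  then have "AE \<omega> in P. I (sym_part g) \<omega> = 1 / 2 * I g \<omega> + 1 / 2 * I (\<lambda>l. cnj (g (- l))) \<omega>"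
    using I_add[OF assms sq_int_cnj_reflect[OF assms], of "1 / 2" "1 / 2"] by simp
  with I_cnj[OF assms] show ?thesis
    by eventually_elim (simp add: complex_eq_iff)
qed

text \<open>The isometry for \<open>g\<close> itself controls only
  \<open>cmod (I g \<omega>)\<close>, which mixes real and imaginary parts. Applied to
  \<open>sym_part g\<close>, whose integral is real, it isolates the real part.\<close>

lemma Re_I_variance:
  assumes "sq_int g"
  shows "expectation (\<lambda>\<omega>. (Re (I g \<omega>))\<^sup>2) = (LINT l|lborel. (cmod (sym_part g l))\<^sup>2)"
proof -
  note [measurable] = I_measurable[OF assms] I_measurable[OF sq_int_sym_part[OF assms]]
  have "expectation (\<lambda>\<omega>. (Re (I g \<omega>))\<^sup>2) = (LINT \<omega>|P. (cmod (I (sym_part g) \<omega>))\<^sup>2)"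
    using Re_I[OF assms] by (intro integral_cong_AE) auto
  then show ?thesis using norm_I_square(2)[OF sq_int_sym_part[OF assms]] by simp
qed

lemma char_Re_I:
  assumes "sq_int g"
  shows "(CLINT \<omega>|P. iexp (Re (I g \<omega>))) = complex_of_real (exp (- (LINT l|lborel. (cmod (sym_part g l))\<^sup>2) / 2))"
  using gaussian_rv_Re_I[OF assms] I_integrable[OF assms] I_mean[OF assms] Re_I_variance[OF assms]
  by (intro gaussian_rv_char) auto

text \<open>The Cramer-Wold device: by linearity a real combination of the coordinates is the real
  part of one stochastic integral. Comparing joint laws is thereby reduced to comparing one norm for
  each \<open>u\<close>.\<close>

lemma char_Re_I_vector:
  fixes g :: "'n::finite \<Rightarrow> real \<Rightarrow> complex" and u :: "real ^ 'n"
  assumes "\<And>i. sq_int (g i)"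
  shows "(CLINT \<omega>|P. iexp (u \<bullet> (\<chi> i. Re (I (g i) \<omega>)))) =
    complex_of_real (exp (- (LINT l|lborel. (cmod (sym_part (\<lambda>l. \<Sum>i\<in>UNIV. of_real (u $ i) * g i l) l))\<^sup>2) / 2))"
proof -
  note [measurable] = I_measurable[OF assms] I_measurable[OF sq_int_sum[OF _ assms]]
  have sq: "sq_int (\<lambda>l. \<Sum>i\<in>UNIV. of_real (u $ i) * g i l)" by (intro sq_int_sum assms) auto
  have "AE \<omega> in P. I (\<lambda>l. \<Sum>i\<in>UNIV. of_real (u $ i) * g i l) \<omega> = (\<Sum>i\<in>UNIV. of_real (u $ i) * I (g i) \<omega>)"
    by (intro I_sum assms) auto
  then have "(CLINT \<omega>|P. iexp (u \<bullet> (\<chi> i. Re (I (g i) \<omega>)))) =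
      (CLINT \<omega>|P. iexp (Re (I (\<lambda>l. \<Sum>i\<in>UNIV. of_real (u $ i) * g i l) \<omega>)))"
    using I_measurable[OF sq] by (intro integral_cong_AE) (auto simp: inner_vec_def)
  then show ?thesis using char_Re_I[OF sq] by simp
qed

end

subsection \<open>Convergence in mean square\<close>

text \<open>Mean-square convergence gives almost sure convergence along subsequences only. If the
  expectations stayed away from the limit along some subsequence, an almost surely convergent
  further subsequence and dominated convergence would contradict this.\<close>

lemma (in prob_space) expectation_tendsto_of_L2_tendsto:
  fixes X :: "real \<Rightarrow> 'n::finite \<Rightarrow> 'a \<Rightarrow> real" and Z :: "'n \<Rightarrow> 'a \<Rightarrow> real" and h :: "real ^ 'n \<Rightarrow> real"
  assumes X: "\<And>\<epsilon> i. \<epsilon> > 0 \<Longrightarrow> X \<epsilon> i \<in> borel_measurable M"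
    and Z [measurable]: "\<And>i. Z i \<in> borel_measurable M"
    and int: "\<And>\<epsilon> i. \<epsilon> > 0 \<Longrightarrow> integrable M (\<lambda>\<omega>. (X \<epsilon> i \<omega> - Z i \<omega>)\<^sup>2)"
    and lim: "\<And>i. ((\<lambda>\<epsilon>. expectation (\<lambda>\<omega>. (X \<epsilon> i \<omega> - Z i \<omega>)\<^sup>2)) \<longlongrightarrow> 0) (at_right 0)"
    and h: "continuous_on UNIV h" "bounded (range h)"
  shows "((\<lambda>\<epsilon>. expectation (\<lambda>\<omega>. h (\<chi> i. X \<epsilon> i \<omega>))) \<longlongrightarrow> expectation (\<lambda>\<omega>. h (\<chi> i. Z i \<omega>))) (at_right 0)"
proof (rule tendsto_at_right_sequentially[of 0 1])
  fix S :: "nat \<Rightarrow> real"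
  assume S: "\<And>n. 0 < S n" "S \<longlonglongrightarrow> 0"
  obtain B where B: "\<And>x. \<bar>h x\<bar> \<le> B" using h(2) by (auto simp: bounded_iff)
  have [measurable]: "h \<in> borel_measurable borel" by (rule borel_measurable_continuous_onI[OF h(1)])
  have [measurable]: "X (S n) i \<in> borel_measurable M" for n i by (intro X S)
  have vec [measurable]: "(\<lambda>\<omega>. \<chi> i. Y i \<omega>) \<in> borel_measurable M" if "\<And>i. Y i \<in> borel_measurable M" for Y :: "'n \<Rightarrow> 'a \<Rightarrow> real"
    using that by (subst borel_measurable_euclidean_space) (auto simp: Basis_vec_def inner_axis)
  have atS: "filterlim S (at_right 0) sequentially"
    using S by (auto simp: filterlim_at less_imp_neq[symmetric])
  define L where "L = expectation (\<lambda>\<omega>. h (\<chi> i. Z i \<omega>))"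
  define a where "a n = expectation (\<lambda>\<omega>. h (\<chi> i. X (S n) i \<omega>))" for n
  have "a \<longlonglongrightarrow> L"
  proof (rule ccontr)
    assume "\<not> a \<longlonglongrightarrow> L"
    then obtain e where e: "e > 0" "\<not> eventually (\<lambda>n. dist (a n) L < e) sequentially"
      by (auto simp: tendsto_iff)
    from not_eventually_sequentiallyD[OF e(2)]
    obtain r :: "nat \<Rightarrow> nat" where r: "strict_mono r" "\<forall>n. \<not> dist (a (r n)) L < e" by blast
    \<comment> \<open>Summing the squares over the coordinates gives a single sequence tending to 0
      in mean, so one subsequence serves all coordinates at once.\<close>
    define D where "D n \<omega> = (\<Sum>i\<in>UNIV. (X (S (r n)) i \<omega> - Z i \<omega>)\<^sup>2)" for n \<omega>
    have "(\<lambda>n. expectation (D n)) \<longlonglongrightarrow> (\<Sum>i\<in>(UNIV::'n set). 0)"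
    proof -
      have "expectation (D n) = (\<Sum>i\<in>UNIV. expectation (\<lambda>\<omega>. (X (S (r n)) i \<omega> - Z i \<omega>)\<^sup>2))" for n
        unfolding D_def[abs_def] by (intro Bochner_Integration.integral_sum int S)
      moreover have "(\<lambda>n. expectation (\<lambda>\<omega>. (X (S (r n)) i \<omega> - Z i \<omega>)\<^sup>2)) \<longlonglongrightarrow> 0" for i
        using LIMSEQ_subseq_LIMSEQ[OF filterlim_compose[OF lim atS] r(1)] by (simp add: comp_def)
      ultimately show ?thesis by (simp only:) (intro tendsto_sum)
    qed
    moreover have "norm (D n \<omega>) = D n \<omega>" for n \<omega> by (simp add: D_def sum_nonneg)
    ultimately have "(\<lambda>n. expectation (\<lambda>\<omega>. norm (D n \<omega>))) \<longlonglongrightarrow> 0" by simp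
    moreover have "integrable M (D n)" for n
      unfolding D_def[abs_def] by (intro Bochner_Integration.integrable_sum int S)
    ultimately obtain q where q: "strict_mono q" "AE \<omega> in M. (\<lambda>n. D (q n) \<omega>) \<longlonglongrightarrow> 0"
      using tendsto_L1_AE_subseq[of M D] by blast
    have "(\<lambda>n. a (r (q n))) \<longlonglongrightarrow> L"
      unfolding a_def L_def
    proof (rule integral_dominated_convergence[where w = "\<lambda>_. B"])
      show "AE \<omega> in M. (\<lambda>n. h (\<chi> i. X (S (r (q n))) i \<omega>)) \<longlonglongrightarrow> h (\<chi> i. Z i \<omega>)"
        using q(2)
      proof eventually_elim
        case (elim \<omega>)
        have "(\<lambda>n. X (S (r (q n))) i \<omega>) \<longlonglongrightarrow> Z i \<omega>" for i
        proof -
          have "(\<lambda>n. (X (S (r (q n))) i \<omega> - Z i \<omega>)\<^sup>2) \<longlonglongrightarrow> 0"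
          proof (rule tendsto_sandwich[OF _ _ tendsto_const elim])
            show "eventually (\<lambda>n. (X (S (r (q n))) i \<omega> - Z i \<omega>)\<^sup>2 \<le> D (q n) \<omega>) sequentially"
              unfolding D_def by (intro always_eventually allI member_le_sum) auto
          qed auto
          then have "(\<lambda>n. sqrt ((X (S (r (q n))) i \<omega> - Z i \<omega>)\<^sup>2)) \<longlonglongrightarrow> sqrt 0" by (rule tendsto_real_sqrt)
          then have "(\<lambda>n. X (S (r (q n))) i \<omega> - Z i \<omega>) \<longlonglongrightarrow> 0" by (simp add: tendsto_rabs_zero_iff)
          then show ?thesis by (simp add: LIM_zero_iff)
        qed
        then have "(\<lambda>n. \<chi> i. X (S (r (q n))) i \<omega>) \<longlonglongrightarrow> (\<chi> i. Z i \<omega>)" by (intro tendsto_vec_lambda)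
        moreover have "isCont h (\<chi> i. Z i \<omega>)" using h by (simp add: continuous_on_eq_continuous_at)
        ultimately show ?case by (auto intro: isCont_tendsto_compose)
      qed
    qed (use B in auto)
    then have "eventually (\<lambda>n. dist (a (r (q n))) L < e) sequentially" using e by (simp add: tendsto_iff)
    then show False using r(2) by simp
  qed
  then show "(\<lambda>n. expectation (\<lambda>\<omega>. h (\<chi> i. X (S n) i \<omega>))) \<longlonglongrightarrow> expectation (\<lambda>\<omega>. h (\<chi> i. Z i \<omega>))"
    by (simp add: a_def[abs_def] L_def)
qed simp

text \<open>Continuity at 0 bounds \<open>f\<close> only on a neighbourhood
  \<open>\<bar>\<eta> * l\<bar> < \<delta>\<close>; there dominated convergence works. Outside it,
  the total mass of \<open>f\<close> costs \<open>1 / \<eta>\<close> after rescaling, and the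
  damping factor wins it back.\<close>

lemma damped_sqrt_density_tendsto:
  fixes f :: "real \<Rightarrow> real" and a :: real
  assumes [measurable]: "f \<in> borel_measurable borel" and nn: "\<And>l. 0 \<le> f l"
    and int: "integrable lborel f" and cont: "isCont f 0" and a: "a > 0" and k: "k \<ge> 1"
  shows "((\<lambda>\<eta>. LINT l|lborel. exp (- a * l ^ (2 * k)) * (sqrt (f (\<eta> * l)) - sqrt (f 0))\<^sup>2) \<longlongrightarrow> 0) (at_right 0)"
proof (rule tendsto_at_right_sequentially[of 0 1])
  fix S :: "nat \<Rightarrow> real"
  assume S: "\<And>n. 0 < S n" "\<And>n. S n < 1" "S \<longlonglongrightarrow> 0"
  obtain \<delta> where \<delta>: "\<delta> > 0" "\<And>l. \<bar>l\<bar> < \<delta> \<Longrightarrow> f l \<le> f 0 + 1"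
  proof -
    from cont obtain \<delta> where "\<delta> > 0" and \<delta>: "\<And>l. dist l 0 < \<delta> \<Longrightarrow> dist (f l) (f 0) < 1"
      unfolding continuous_at_eps_delta by (metis zero_less_one)
    have "f l \<le> f 0 + 1" if "\<bar>l\<bar> < \<delta>" for l using \<delta>[of l] that by (auto simp: dist_real_def)
    with \<open>\<delta> > 0\<close> show ?thesis by (rule that)
  qed
  define E where "E l = exp (- a * l ^ (2 * k))" for l
  have [measurable]: "E \<in> borel_measurable borel" unfolding E_def[abs_def] by measurable
  have E: "integrable lborel E" unfolding E_def[abs_def] by (rule integrable_exp_even_power[OF a k])
  have Epos: "E l > 0" for l by (simp add: E_def)
  have sq: "(sqrt u - sqrt v)\<^sup>2 \<le> u + v" if "0 \<le> u" "0 \<le> v" for u v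
    using that by (simp add: power2_diff)
  \<comment> \<open>The part with a fixed majorant: the full square near 0, and far out only the
    share of the constant \<open>f 0\<close>. What is missing far out is at most
    \<open>f (\<eta> * l)\<close>.\<close>
  define N where "N \<eta> l = (if \<bar>\<eta> * l\<bar> < \<delta> then (sqrt (f (\<eta> * l)) - sqrt (f 0))\<^sup>2 else f 0)" for \<eta> l
  have [measurable]: "N \<eta> \<in> borel_measurable borel" for \<eta> unfolding N_def[abs_def] by measurable
  have N0: "0 \<le> N \<eta> l" for \<eta> l by (simp add: N_def nn)
  have N1: "N \<eta> l \<le> 2 * f 0 + 1" for \<eta> l
    using sq[OF nn[of "\<eta> * l"] nn[of 0]] \<delta>(2)[of "\<eta> * l"] nn[of 0] unfolding N_def by (simp; linarith)
  have EN: "integrable lborel (\<lambda>l. E l * N \<eta> l)" for \<eta>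
    by (rule Bochner_Integration.integrable_bound[OF integrable_mult_right[OF E, of "2 * f 0 + 1"]])
       (use N0 N1 Epos nn in \<open>auto simp: abs_mult less_imp_le mult.commute[of "E _"] intro!: mult_right_mono\<close>)
  define F where "F = (LINT l|lborel. f l)"
  have fS: "integrable lborel (\<lambda>l. f (S n * l))" "(LINT l|lborel. f (S n * l)) = F / S n" for n
    using lborel_integrable_real_affine[OF int, of "S n" 0] lborel_integral_real_affine[of "S n" f 0] S(1)[of n]
    by (auto simp: F_def field_simps)
  \<comment> \<open>The crude estimate \<open>exp (- y) \<le> 1 / y\<close> is strong enough, since
    it gains the power \<open>2 * k\<close> of \<open>S n\<close>.\<close>
  have far: "\<bar>l\<bar> * S n \<ge> \<delta> \<Longrightarrow> E l \<le> S n ^ (2 * k) / (a * \<delta> ^ (2 * k))" for l n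
  proof -
    assume "\<bar>l\<bar> * S n \<ge> \<delta>"
    then have "\<delta> / S n \<le> \<bar>l\<bar>" using S(1)[of n] by (simp add: field_simps)
    then have "(\<delta> / S n) ^ (2 * k) \<le> \<bar>l\<bar> ^ (2 * k)" using \<delta> S(1)[of n] by (intro power_mono) auto
    then have le: "a * (\<delta> / S n) ^ (2 * k) \<le> a * l ^ (2 * k)" using a by (simp add: power_even_abs)
    define y where "y = a * (\<delta> / S n) ^ (2 * k)"
    have y: "y > 0" using a \<delta> S(1)[of n] by (simp add: y_def)
    have "E l \<le> exp (- y)" using le by (simp add: E_def y_def)
    also have "\<dots> \<le> 1 / y"
      using exp_ge_add_one_self[of y] y by (simp add: exp_minus field_simps; linarith)
    finally show ?thesis by (simp add: y_def power_divide)
  qed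
  have bound: "E l * (sqrt (f (S n * l)) - sqrt (f 0))\<^sup>2 \<le>
       E l * N (S n) l + S n ^ (2 * k) / (a * \<delta> ^ (2 * k)) * f (S n * l)" for l n
  proof (cases "\<bar>S n * l\<bar> < \<delta>")
    case True
    then show ?thesis using a \<delta> S(1)[of n] nn by (simp add: N_def)
  next
    case False
    have "E l * (sqrt (f (S n * l)) - sqrt (f 0))\<^sup>2 \<le> E l * (f (S n * l) + f 0)"
      using sq nn Epos by (intro mult_left_mono) (auto simp: less_imp_le)
    also have "\<dots> = E l * f 0 + E l * f (S n * l)" by (simp add: algebra_simps)
    also have "E l * f (S n * l) \<le> S n ^ (2 * k) / (a * \<delta> ^ (2 * k)) * f (S n * l)"
      using False S(1)[of n] by (intro mult_right_mono far nn) (auto simp: abs_mult mult.commute)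
    finally show ?thesis using False by (simp add: N_def)
  qed
  show "(\<lambda>n. LINT l|lborel. exp (- a * l ^ (2 * k)) * (sqrt (f (S n * l)) - sqrt (f 0))\<^sup>2) \<longlonglongrightarrow> 0"
    unfolding E_def[symmetric]
  proof (rule tendsto_sandwich[OF _ _ tendsto_const])
    show "\<forall>\<^sub>F n in sequentially. 0 \<le> (LINT l|lborel. E l * (sqrt (f (S n * l)) - sqrt (f 0))\<^sup>2)"
      using Epos by (intro always_eventually allI Bochner_Integration.integral_nonneg) (auto simp: less_imp_le)
    show "\<forall>\<^sub>F n in sequentially. (LINT l|lborel. E l * (sqrt (f (S n * l)) - sqrt (f 0))\<^sup>2) \<le>
       (LINT l|lborel. E l * N (S n) l) + F / (a * \<delta> ^ (2 * k)) * S n"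
    proof (intro always_eventually allI)
      fix n
      have "(LINT l|lborel. E l * (sqrt (f (S n * l)) - sqrt (f 0))\<^sup>2) \<le>
         (LINT l|lborel. E l * N (S n) l + S n ^ (2 * k) / (a * \<delta> ^ (2 * k)) * f (S n * l))"
      proof (rule integral_mono')
        show "integrable lborel (\<lambda>l. E l * N (S n) l + S n ^ (2 * k) / (a * \<delta> ^ (2 * k)) * f (S n * l))"
          by (intro Bochner_Integration.integrable_add EN integrable_mult_right fS)
        show "0 \<le> E l * N (S n) l + S n ^ (2 * k) / (a * \<delta> ^ (2 * k)) * f (S n * l)" for l
          using Epos[of l] N0 nn a \<delta> S(1)[of n] by (intro add_nonneg_nonneg mult_nonneg_nonneg divide_nonneg_nonneg) (auto simp: less_imp_le)
      qed (rule bound)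
      also have "\<dots> = (LINT l|lborel. E l * N (S n) l) + S n ^ (2 * k) / (a * \<delta> ^ (2 * k)) * (F / S n)"
        using EN fS by simp
      \<comment> \<open>Gain \<open>2 * k\<close> against loss 1 leaves the exponent
        \<open>2 * k - 1 \<ge> 1\<close>; with \<open>S n < 1\<close> at least one power of
        \<open>S n\<close> survives.\<close>
      also have "S n ^ (2 * k) / (a * \<delta> ^ (2 * k)) * (F / S n) \<le> F / (a * \<delta> ^ (2 * k)) * S n"
      proof -
        have "S n ^ (2 * k) / S n = S n ^ (2 * k - 1)"
          using S(1)[of n] k by (simp add: power_diff)
        also have "\<dots> \<le> S n ^ 1" using S(1)[of n] S(2)[of n] k by (intro power_decreasing) auto
        finally have *: "S n ^ (2 * k) / S n \<le> S n" by simp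
        have "S n ^ (2 * k) / (a * \<delta> ^ (2 * k)) * (F / S n) = F / (a * \<delta> ^ (2 * k)) * (S n ^ (2 * k) / S n)" by simp
        also have "\<dots> \<le> F / (a * \<delta> ^ (2 * k)) * S n"
          using * a \<delta> nn by (intro mult_left_mono divide_nonneg_nonneg) (auto simp: F_def)
        finally show ?thesis .
      qed
      finally show "(LINT l|lborel. E l * (sqrt (f (S n * l)) - sqrt (f 0))\<^sup>2) \<le>
         (LINT l|lborel. E l * N (S n) l) + F / (a * \<delta> ^ (2 * k)) * S n" by simp
    qed
    have "(\<lambda>n. LINT l|lborel. E l * N (S n) l) \<longlonglongrightarrow> (LINT (l::real)|lborel. 0)"
    proof (rule integral_dominated_convergence[where w = "\<lambda>l. (2 * f 0 + 1) * E l"])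
      show "AE l in lborel. (\<lambda>n. E l * N (S n) l) \<longlonglongrightarrow> 0"
      proof (intro AE_I2)
        fix l
        have Sl: "(\<lambda>n. S n * l) \<longlonglongrightarrow> 0" using tendsto_mult_left_zero[OF S(3)] by simp
        have "(\<lambda>n. (sqrt (f (S n * l)) - sqrt (f 0))\<^sup>2) \<longlonglongrightarrow> (sqrt (f 0) - sqrt (f 0))\<^sup>2"
          by (intro tendsto_intros isCont_tendsto_compose[OF cont Sl])
        moreover have "\<forall>\<^sub>F n in sequentially. (sqrt (f (S n * l)) - sqrt (f 0))\<^sup>2 = N (S n) l"
          using order_tendstoD(2)[OF tendsto_rabs_zero[OF Sl] \<delta>(1)] by eventually_elim (simp add: N_def)
        ultimately have "(\<lambda>n. N (S n) l) \<longlonglongrightarrow> 0" by (simp add: tendsto_cong)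
        then show "(\<lambda>n. E l * N (S n) l) \<longlonglongrightarrow> 0" by (rule tendsto_mult_right_zero)
      qed
      show "AE l in lborel. norm (E l * N (S n) l) \<le> (2 * f 0 + 1) * E l" for n
        using N0 N1 Epos by (auto simp: abs_mult less_imp_le mult.commute[of "E _"] intro!: mult_right_mono)
    qed (use E in auto)
    moreover have "(\<lambda>n. F / (a * \<delta> ^ (2 * k)) * S n) \<longlonglongrightarrow> 0" by (rule tendsto_mult_right_zero[OF S(3)])
    ultimately show "(\<lambda>n. (LINT l|lborel. E l * N (S n) l) + F / (a * \<delta> ^ (2 * k)) * S n) \<longlonglongrightarrow> 0"
      using tendsto_add by fastforce
  qed
qed simp

subsection \<open>The rescaled and the limit field\<close>

definition heat_mode :: "nat \<Rightarrow> real \<Rightarrow> real \<Rightarrow> real \<Rightarrow> complex" where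
  "heat_mode m t x l = exp (\<i> * complex_of_real (l * x) - complex_of_real (l ^ m * t))"

lemma borel_measurable_heat_mode [measurable]: "heat_mode m t x \<in> borel_measurable borel"
  unfolding heat_mode_def[abs_def] by measurable

lemma norm_heat_mode: "cmod (heat_mode m t x l) = exp (- (l ^ m * t))"
  by (simp add: heat_mode_def norm_exp_eq_Re)

lemma norm_heat_mode_square: "(cmod (heat_mode m t x l))\<^sup>2 = exp (- (2 * t) * l ^ m)"
  by (simp add: norm_heat_mode power2_eq_square mult_ac flip: exp_add)

lemma cnj_heat_mode: "even m \<Longrightarrow> cnj (heat_mode m t x (- l)) = heat_mode m t x l"
  by (simp add: heat_mode_def exp_cnj)

text \<open>Conjugation flips the phase but not the damping: positions subtract and times add. This
  is why the limit covariance depends on \<open>x - x'\<close> and \<open>t + t'\<close>.\<close>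

lemma heat_mode_mult_cnj:
  "heat_mode m t x l * cnj (heat_mode m t' x' l) = heat_mode m (t + t') (x - x') l"
  unfolding heat_mode_def exp_cnj exp_add[symmetric]
  by (intro arg_cong[of _ _ exp]) (simp add: algebra_simps)

lemma Re_heat_mode: "Re (heat_mode m t x l) = cos (l * x) * exp (- t * l ^ m)"
  by (simp add: heat_mode_def Re_exp mult_ac)

lemma sq_int_heat_mode:
  assumes "t > 0" "k \<ge> 1"
  shows "sq_int (heat_mode (2 * k) t x)"
  using integrable_exp_even_power[of "2 * t" k] assms
  unfolding sq_int_def norm_heat_mode_square by simp

lemma sq_int_heat_mode_sqrt:
  assumes t: "t \<ge> 0" and [measurable]: "f \<in> borel_measurable borel" and nn: "\<And>l. 0 \<le> f l"
    and int: "integrable lborel f"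
  shows "sq_int (\<lambda>l. heat_mode (2 * k) t x l * complex_of_real (sqrt (f l)))"
  unfolding sq_int_def
proof
  show "integrable lborel (\<lambda>l. (cmod (heat_mode (2 * k) t x l * complex_of_real (sqrt (f l))))\<^sup>2)"
  proof (rule Bochner_Integration.integrable_bound[OF int])
    have "exp (- (2 * t) * l ^ (2 * k)) * f l \<le> 1 * f l" for l
      using t nn by (intro mult_right_mono) auto
    then show "AE l in lborel. norm ((cmod (heat_mode (2 * k) t x l * complex_of_real (sqrt (f l))))\<^sup>2) \<le> norm (f l)"
      using nn by (simp add: norm_mult power_mult_distrib norm_heat_mode_square)
  qed measurable
qed measurable

text \<open>The scaling of time and space is the one under which the symbol of the equation is
  invariant when frequencies shrink by \<open>sqrt \<epsilon>\<close>.\<close>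

lemma heat_mode_rescale:
  assumes "\<epsilon> > 0"
  shows "heat_mode m (t * \<epsilon> powr (- real m / 2)) (x * \<epsilon> powr (- 1 / 2)) (sqrt \<epsilon> * l) = heat_mode m t x l"
proof -
  have 1: "sqrt \<epsilon> * \<epsilon> powr (- 1 / 2) = 1"
    using assms by (simp add: powr_half_sqrt[symmetric] flip: powr_add)
  have 2: "sqrt \<epsilon> ^ m * \<epsilon> powr (- real m / 2) = 1"
    using assms by (simp add: powr_half_sqrt[symmetric] powr_powr flip: powr_realpow powr_add)
  have "sqrt \<epsilon> * l * (x * \<epsilon> powr (- 1 / 2)) = (sqrt \<epsilon> * \<epsilon> powr (- 1 / 2)) * (l * x)"
    "(sqrt \<epsilon> * l) ^ m * (t * \<epsilon> powr (- real m / 2)) = (sqrt \<epsilon> ^ m * \<epsilon> powr (- real m / 2)) * (l ^ m * t)"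
    by (simp_all add: power_mult_distrib)
  then show ?thesis unfolding heat_mode_def 1 2 by (simp only: mult_1)
qed

section \<open>Law, mean-square limit and covariance of the rescaled field\<close>

context white_noise
begin

text \<open>The convolution with \<open>M\<close> is a deterministic constant and the stochastic
  integral has mean zero, so centring removes exactly the former.\<close>

lemma rescaled_field_eq:
  fixes x :: real and k :: nat
  assumes "\<epsilon> > 0" "t > 0" "f \<in> borel_measurable borel" "\<And>l. 0 \<le> f l" "integrable lborel f"
  defines "g \<equiv> (\<lambda>l. heat_mode (2 * k) (t * \<epsilon> powr (- real (2 * k) / 2)) (x * \<epsilon> powr (- 1 / 2)) l * complex_of_real (sqrt (f l)))"
  shows "rescaled_field P M (2 * k) f I \<epsilon> t x \<omega> = \<epsilon> powr (- 1 / 4) * Re (I g \<omega>)"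
    and "sq_int g"
proof -
  show g: "sq_int g" unfolding g_def using assms by (intro sq_int_heat_mode_sqrt) auto
  define K where "K = (LINT y|lborel. complex_of_real (M (x * \<epsilon> powr (- 1 / 2) - y)) * fund_sol (2 * k) (t * \<epsilon> powr (- real (2 * k) / 2)) y)"
  have sol: "heat_sol M (2 * k) f I (t * \<epsilon> powr (- real (2 * k) / 2)) (x * \<epsilon> powr (- 1 / 2)) \<omega> = K + I g \<omega>" for \<omega>
    unfolding heat_sol_def g_def heat_mode_def K_def ..
  have "expectation (\<lambda>\<omega>. K + I g \<omega>) = K"
    using I_integrable[OF g] I_mean[OF g] by (simp add: prob_space)
  then show "rescaled_field P M (2 * k) f I \<epsilon> t x \<omega> = \<epsilon> powr (- 1 / 4) * Re (I g \<omega>)"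
    unfolding rescaled_field_def sol by simp
qed

lemma Re_I_scale:
  assumes "sq_int g"
  shows "AE \<omega> in P. Re (I (\<lambda>l. complex_of_real c * g l) \<omega>) = c * Re (I g \<omega>)"
  using I_add[OF assms assms, of "complex_of_real c" 0] by (auto elim!: eventually_mono)

lemma measurable_vec_Re_I:
  assumes "\<And>i. sq_int (g i)"
  shows "(\<lambda>\<omega>. \<chi> i. c * Re (I (g i) \<omega>)) \<in> borel_measurable P"
  using I_measurable[OF assms]
  by (subst borel_measurable_euclidean_space) (auto simp: Basis_vec_def inner_axis)

text \<open>Both vectors are Gaussian with laws given by norms of symmetrised integrands, and
  \<open>c\<^sup>2 * sqrt \<epsilon> = 1\<close> makes these norms equal. Since only norms matter,
  the density \<open>f\<close> can be exchanged for its version \<open>g\<close> in the same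
  stroke.\<close>

lemma rescaled_field_law:
  fixes tt xx :: "'n::finite \<Rightarrow> real" and h :: "real ^ 'n \<Rightarrow> real"
  assumes \<epsilon>: "\<epsilon> > 0" and tt: "\<And>i. tt i > 0"
    and f: "f \<in> borel_measurable borel" "\<And>l. 0 \<le> f l" "integrable lborel f"
    and g: "g \<in> borel_measurable borel" "\<And>l. 0 \<le> g l" "integrable lborel g"
    and eq: "AE l in lborel. f l = g l"
    and h: "continuous_on UNIV h" "bounded (range h)"
  shows "expectation (\<lambda>\<omega>. h (\<chi> i. rescaled_field P M (2 * k) f I \<epsilon> (tt i) (xx i) \<omega>)) =
    expectation (\<lambda>\<omega>. h (\<chi> i. Re (I (\<lambda>l. heat_mode (2 * k) (tt i) (xx i) l * complex_of_real (sqrt (g (sqrt \<epsilon> * l)))) \<omega>)))"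
proof -
  define c where "c = \<epsilon> powr (- 1 / 4)"
  define G where "G i l = heat_mode (2 * k) (tt i * \<epsilon> powr (- real (2 * k) / 2)) (xx i * \<epsilon> powr (- 1 / 2)) l * complex_of_real (sqrt (f l))" for i l
  define G' where "G' i l = heat_mode (2 * k) (tt i) (xx i) l * complex_of_real (sqrt (g (sqrt \<epsilon> * l)))" for i l
  have c2: "c\<^sup>2 * sqrt \<epsilon> = 1"
    using \<epsilon> by (simp add: c_def powr_half_sqrt[symmetric] power2_eq_square flip: powr_add)
  have sqG: "sq_int (G i)" for i
    unfolding G_def[abs_def] using rescaled_field_eq(2)[OF \<epsilon> tt f] .
  have sqG': "sq_int (G' i)" for i
    unfolding G'_def[abs_def] using tt[of i] g \<epsilon> lborel_integrable_real_affine[OF g(3), of "sqrt \<epsilon>" 0]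
    by (intro sq_int_heat_mode_sqrt) auto
  have sqcG: "sq_int (\<lambda>l. complex_of_real c * G i l)" for i
    using sq_int_add[OF sqG sqG, of "complex_of_real c" i 0 i] by simp
  note [measurable] = f(1) g(1)
  have "Measurable.pred borel (\<lambda>l. f l = g l)" by measurable
  \<comment> \<open>Symmetrising evaluates the density at both signs of the rescaled frequency, so
    the exceptional null set is transported by two affine maps.\<close>
  then have ae1: "AE l in lborel. f (sqrt \<epsilon> * l) = g (sqrt \<epsilon> * l)"
    and ae2: "AE l in lborel. f (- (sqrt \<epsilon> * l)) = g (- (sqrt \<epsilon> * l))"
    using AE_borel_affine[of "sqrt \<epsilon>" "\<lambda>l. f l = g l" 0] AE_borel_affine[of "- sqrt \<epsilon>" "\<lambda>l. f l = g l" 0] eq \<epsilon>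
    by auto
  have char: "(CLINT \<omega>|P. iexp (u \<bullet> (\<chi> i. Re (I (\<lambda>l. complex_of_real c * G i l) \<omega>)))) =
      (CLINT \<omega>|P. iexp (u \<bullet> (\<chi> i. Re (I (G' i) \<omega>))))" for u :: "real ^ 'n"
  proof -
    define H where "H l = (\<Sum>i\<in>UNIV. complex_of_real (u $ i) * (complex_of_real c * G i l))" for l
    define H' where "H' l = (\<Sum>i\<in>UNIV. complex_of_real (u $ i) * G' i l)" for l
    have H: "sq_int H" unfolding H_def[abs_def] by (intro sq_int_sum sqcG) auto
    have H': "sq_int H'" unfolding H'_def[abs_def] by (intro sq_int_sum sqG') auto
    note [measurable] = sq_int_measurable[OF sq_int_sym_part[OF H]] sq_int_measurable[OF sq_int_sym_part[OF H']]
    have "AE l in lborel. sym_part H (sqrt \<epsilon> * l) = complex_of_real c * sym_part H' l"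
      using ae1 ae2
    proof eventually_elim
      case (elim l)
      have "G i (sqrt \<epsilon> * l) = G' i l" "G i (- (sqrt \<epsilon> * l)) = G' i (- l)" for i
        using elim heat_mode_rescale[OF \<epsilon>, of "2 * k" "tt i" "xx i" l] heat_mode_rescale[OF \<epsilon>, of "2 * k" "tt i" "xx i" "- l"]
        by (simp_all add: G_def G'_def)
      then have "H (sqrt \<epsilon> * l) = complex_of_real c * H' l" "H (- (sqrt \<epsilon> * l)) = complex_of_real c * H' (- l)"
        by (simp_all add: H_def H'_def sum_distrib_left mult_ac)
      then show ?case by (simp add: sym_part_def field_simps)
    qed
    then have "(LINT l|lborel. (cmod (sym_part H (0 + sqrt \<epsilon> * l)))\<^sup>2) = (LINT l|lborel. c\<^sup>2 * (cmod (sym_part H' l))\<^sup>2)"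
      by (intro integral_cong_AE) (auto simp: norm_mult power_mult_distrib elim!: eventually_mono)
    then have "(LINT l|lborel. (cmod (sym_part H l))\<^sup>2) = c\<^sup>2 * sqrt \<epsilon> * (LINT l|lborel. (cmod (sym_part H' l))\<^sup>2)"
      using \<epsilon> by (subst lborel_integral_real_affine[of "sqrt \<epsilon>" _ 0]) auto
    then have "(LINT l|lborel. (cmod (sym_part H l))\<^sup>2) = (LINT l|lborel. (cmod (sym_part H' l))\<^sup>2)"
      by (simp add: c2)
    then show ?thesis
      using char_Re_I_vector[OF sqcG, of u] char_Re_I_vector[OF sqG', of u]
      unfolding H_def[abs_def] H'_def[abs_def] by simp
  qed
  have [measurable]: "h \<in> borel_measurable borel" by (rule borel_measurable_continuous_onI[OF h(1)])
  note [measurable] = measurable_vec_Re_I[OF sqG] measurable_vec_Re_I[OF sqcG, of 1, simplified]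
  have "expectation (\<lambda>\<omega>. h (\<chi> i. rescaled_field P M (2 * k) f I \<epsilon> (tt i) (xx i) \<omega>)) =
     expectation (\<lambda>\<omega>. h (\<chi> i. c * Re (I (G i) \<omega>)))"
    unfolding rescaled_field_eq(1)[OF \<epsilon> tt f] c_def G_def[abs_def] ..
  also have "\<dots> = expectation (\<lambda>\<omega>. h (\<chi> i. Re (I (\<lambda>l. complex_of_real c * G i l) \<omega>)))"
  proof (intro integral_cong_AE)
    have "AE \<omega> in P. \<forall>i. Re (I (\<lambda>l. complex_of_real c * G i l) \<omega>) = c * Re (I (G i) \<omega>)"
      by (intro eventually_all_finite Re_I_scale sqG)
    then show "AE \<omega> in P. h (\<chi> i. c * Re (I (G i) \<omega>)) = h (\<chi> i. Re (I (\<lambda>l. complex_of_real c * G i l) \<omega>))"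
      by eventually_elim simp
  qed measurable
  also have "\<dots> = expectation (\<lambda>\<omega>. h (\<chi> i. Re (I (G' i) \<omega>)))"
    using measurable_vec_Re_I[OF sqcG, of 1] measurable_vec_Re_I[OF sqG', of 1]
    by (intro expectation_eq_of_char_eq char h) auto
  finally show ?thesis unfolding G'_def[abs_def] .
qed

text \<open>The difference to the limit is the real part of a single stochastic integral, hence
  bounded by its modulus. The isometry turns this bound into a damped integral with rate
  \<open>2 * t\<close>.\<close>

lemma rescaled_modes_L2_tendsto:
  fixes x :: real
  assumes f [measurable]: "f \<in> borel_measurable borel" and nn: "\<And>l. 0 \<le> f l" and int: "integrable lborel f"
    and cont: "isCont f 0" and t: "t > 0" and k: "k \<ge> 1"
  defines "G \<equiv> (\<lambda>\<epsilon> l. heat_mode (2 * k) t x l * complex_of_real (sqrt (f (sqrt \<epsilon> * l))))"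
    and "Z \<equiv> (\<lambda>\<omega>. sqrt (f 0) * Re (I (heat_mode (2 * k) t x) \<omega>))"
  shows "\<epsilon> > 0 \<Longrightarrow> sq_int (G \<epsilon>)"
    and "\<epsilon> > 0 \<Longrightarrow> integrable P (\<lambda>\<omega>. (Re (I (G \<epsilon>) \<omega>) - Z \<omega>)\<^sup>2)"
    and "((\<lambda>\<epsilon>. expectation (\<lambda>\<omega>. (Re (I (G \<epsilon>) \<omega>) - Z \<omega>)\<^sup>2)) \<longlongrightarrow> 0) (at_right 0)"
proof -
  have sqG: "sq_int (G \<epsilon>)" if "\<epsilon> > 0" for \<epsilon>
    unfolding G_def using t nn that lborel_integrable_real_affine[OF int, of "sqrt \<epsilon>" 0]
    by (intro sq_int_heat_mode_sqrt) auto
  have sqe: "sq_int (heat_mode (2 * k) t x)" by (rule sq_int_heat_mode[OF t k])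
  define J where "J \<epsilon> = (\<lambda>l. 1 * G \<epsilon> l + complex_of_real (- sqrt (f 0)) * heat_mode (2 * k) t x l)" for \<epsilon>
  have sqJ: "sq_int (J \<epsilon>)" if "\<epsilon> > 0" for \<epsilon> unfolding J_def by (intro sq_int_add sqG that sqe)
  have Z: "Z \<in> borel_measurable P" unfolding Z_def using I_measurable[OF sqe] by measurable
  have ae: "AE \<omega> in P. (Re (I (G \<epsilon>) \<omega>) - Z \<omega>)\<^sup>2 \<le> (cmod (I (J \<epsilon>) \<omega>))\<^sup>2" if "\<epsilon> > 0" for \<epsilon>
  proof -
    have "AE \<omega> in P. I (J \<epsilon>) \<omega> = 1 * I (G \<epsilon>) \<omega> + complex_of_real (- sqrt (f 0)) * I (heat_mode (2 * k) t x) \<omega>"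
      unfolding J_def by (intro I_add sqG that sqe)
    then show ?thesis
    proof eventually_elim
      case (elim \<omega>)
      then have "Re (I (G \<epsilon>) \<omega>) - Z \<omega> = Re (I (J \<epsilon>) \<omega>)" by (simp add: Z_def)
      then show ?case by (simp add: cmod_power2)
    qed
  qed
  have m: "(\<lambda>\<omega>. (Re (I (G \<epsilon>) \<omega>) - Z \<omega>)\<^sup>2) \<in> borel_measurable P" if "\<epsilon> > 0" for \<epsilon>
    using Z I_measurable[OF sqG[OF that]] by measurable
  have int2: "integrable P (\<lambda>\<omega>. (Re (I (G \<epsilon>) \<omega>) - Z \<omega>)\<^sup>2)" if "\<epsilon> > 0" for \<epsilon>
    using ae[OF that] by (intro Bochner_Integration.integrable_bound[OF norm_I_square(1)[OF sqJ[OF that]] m[OF that]]) auto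
  show "\<epsilon> > 0 \<Longrightarrow> sq_int (G \<epsilon>)" "\<epsilon> > 0 \<Longrightarrow> integrable P (\<lambda>\<omega>. (Re (I (G \<epsilon>) \<omega>) - Z \<omega>)\<^sup>2)"
    by (fact sqG, fact int2)
  have le: "expectation (\<lambda>\<omega>. (Re (I (G \<epsilon>) \<omega>) - Z \<omega>)\<^sup>2) \<le>
     (LINT l|lborel. exp (- (2 * t) * l ^ (2 * k)) * (sqrt (f (sqrt \<epsilon> * l)) - sqrt (f 0))\<^sup>2)" if "\<epsilon> > 0" for \<epsilon>
  proof -
    have "expectation (\<lambda>\<omega>. (Re (I (G \<epsilon>) \<omega>) - Z \<omega>)\<^sup>2) \<le> expectation (\<lambda>\<omega>. (cmod (I (J \<epsilon>) \<omega>))\<^sup>2)"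
      by (intro integral_mono_AE int2 that norm_I_square(1) sqJ ae)
    also have "\<dots> = (LINT l|lborel. (cmod (J \<epsilon> l))\<^sup>2)" by (rule norm_I_square(2)[OF sqJ[OF that]])
    also have "(\<lambda>l. (cmod (J \<epsilon> l))\<^sup>2) = (\<lambda>l. exp (- (2 * t) * l ^ (2 * k)) * (sqrt (f (sqrt \<epsilon> * l)) - sqrt (f 0))\<^sup>2)"
    proof
      fix l
      have "J \<epsilon> l = heat_mode (2 * k) t x l * complex_of_real (sqrt (f (sqrt \<epsilon> * l)) - sqrt (f 0))"
        by (simp add: J_def G_def algebra_simps)
      then show "(cmod (J \<epsilon> l))\<^sup>2 = exp (- (2 * t) * l ^ (2 * k)) * (sqrt (f (sqrt \<epsilon> * l)) - sqrt (f 0))\<^sup>2"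
        by (simp only: norm_mult power_mult_distrib norm_heat_mode_square norm_of_real power2_abs)
    qed
    finally show ?thesis .
  qed
  \<comment> \<open>The damped integral was treated in the frequency scale \<open>\<eta>\<close>,
    which is \<open>sqrt \<epsilon>\<close> here.\<close>
  have sqrt0: "filterlim sqrt (at_right 0) (at_right (0::real))"
    unfolding filterlim_at
    by (auto simp: eventually_at_right_less intro!: tendsto_eq_intros eventually_at_right_less[THEN eventually_mono])
  have "((\<lambda>\<epsilon>. LINT l|lborel. exp (- (2 * t) * l ^ (2 * k)) * (sqrt (f (sqrt \<epsilon> * l)) - sqrt (f 0))\<^sup>2) \<longlongrightarrow> 0) (at_right 0)"
    using t by (intro filterlim_compose[OF damped_sqrt_density_tendsto[OF f nn int cont _ k] sqrt0]) auto
  then show "((\<lambda>\<epsilon>. expectation (\<lambda>\<omega>. (Re (I (G \<epsilon>) \<omega>) - Z \<omega>)\<^sup>2)) \<longlongrightarrow> 0) (at_right 0)"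
  proof (rule tendsto_sandwich[OF _ _ tendsto_const, rotated -1])
    show "\<forall>\<^sub>F \<epsilon> in at_right 0. expectation (\<lambda>\<omega>. (Re (I (G \<epsilon>) \<omega>) - Z \<omega>)\<^sup>2) \<le>
       (LINT l|lborel. exp (- (2 * t) * l ^ (2 * k)) * (sqrt (f (sqrt \<epsilon> * l)) - sqrt (f 0))\<^sup>2)"
      using eventually_at_right_less[of 0] by eventually_elim (rule le)
  qed auto
qed

text \<open>The field is built from \<open>f\<close>, but the limit carries \<open>g 0\<close>:
  almost everywhere equality leaves the value \<open>f 0\<close> undetermined, and continuity is
  available for \<open>g\<close>.\<close>

theorem rescaled_field_tendsto:
  fixes tt xx :: "'n::finite \<Rightarrow> real" and h :: "real ^ 'n \<Rightarrow> real"
  assumes k: "k \<ge> 1" and tt: "\<And>i. tt i > 0"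
    and f: "f \<in> borel_measurable borel" "\<And>l. 0 \<le> f l" "integrable lborel f"
    and g: "g \<in> borel_measurable borel" "\<And>l. 0 \<le> g l" "integrable lborel g" "isCont g 0"
    and eq: "AE l in lborel. f l = g l"
    and h: "continuous_on UNIV h" "bounded (range h)"
  shows "((\<lambda>\<epsilon>. expectation (\<lambda>\<omega>. h (\<chi> i. rescaled_field P M (2 * k) f I \<epsilon> (tt i) (xx i) \<omega>)))
     \<longlongrightarrow> expectation (\<lambda>\<omega>. h (\<chi> i. limit_field (g 0) (2 * k) I (tt i) (xx i) \<omega>))) (at_right 0)"
proof -
  define X where "X \<epsilon> i \<omega> = Re (I (\<lambda>l. heat_mode (2 * k) (tt i) (xx i) l * complex_of_real (sqrt (g (sqrt \<epsilon> * l)))) \<omega>)" for \<epsilon> i \<omega>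
  define Z where "Z i \<omega> = sqrt (g 0) * Re (I (heat_mode (2 * k) (tt i) (xx i)) \<omega>)" for i \<omega>
  have "((\<lambda>\<epsilon>. expectation (\<lambda>\<omega>. h (\<chi> i. X \<epsilon> i \<omega>))) \<longlongrightarrow> expectation (\<lambda>\<omega>. h (\<chi> i. Z i \<omega>))) (at_right 0)"
  proof (rule expectation_tendsto_of_L2_tendsto[OF _ _ _ _ h])
    show "X \<epsilon> i \<in> borel_measurable P" if "\<epsilon> > 0" for \<epsilon> i
      unfolding X_def[abs_def] using I_measurable[OF rescaled_modes_L2_tendsto(1)[OF g tt k that]] by measurable
    show "Z i \<in> borel_measurable P" for i
      unfolding Z_def[abs_def] using I_measurable[OF sq_int_heat_mode[OF tt k]] by measurable
    show "integrable P (\<lambda>\<omega>. (X \<epsilon> i \<omega> - Z i \<omega>)\<^sup>2)" if "\<epsilon> > 0" for \<epsilon> i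
      unfolding X_def Z_def by (rule rescaled_modes_L2_tendsto(2)[OF g tt k that])
    show "((\<lambda>\<epsilon>. expectation (\<lambda>\<omega>. (X \<epsilon> i \<omega> - Z i \<omega>)\<^sup>2)) \<longlongrightarrow> 0) (at_right 0)" for i
      unfolding X_def Z_def by (rule rescaled_modes_L2_tendsto(3)[OF g tt k])
  qed
  moreover have "\<forall>\<^sub>F \<epsilon> in at_right 0. expectation (\<lambda>\<omega>. h (\<chi> i. X \<epsilon> i \<omega>)) =
      expectation (\<lambda>\<omega>. h (\<chi> i. rescaled_field P M (2 * k) f I \<epsilon> (tt i) (xx i) \<omega>))"
    using eventually_at_right_less[of 0]
    by eventually_elim (unfold X_def, rule rescaled_field_law[OF _ tt f g(1-3) eq h, symmetric])
  moreover have "limit_field (g 0) (2 * k) I (tt i) (xx i) \<omega> = Z i \<omega>" for i \<omega>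
    by (simp add: limit_field_def Z_def heat_mode_def[abs_def])
  ultimately show ?thesis by (simp add: tendsto_cong)
qed

theorem limit_field_covariance:
  assumes k: "k \<ge> 1" and C: "C \<ge> 0" and t: "t > 0" and t': "t' > 0"
  shows "expectation (\<lambda>\<omega>. (limit_field C (2 * k) I t x \<omega> - expectation (limit_field C (2 * k) I t x)) *
       (limit_field C (2 * k) I t' x' \<omega> - expectation (limit_field C (2 * k) I t' x'))) =
     C * (LINT l|lborel. cos (l * (x - x')) * exp (- (t + t') * l ^ (2 * k)))"
proof -
  have lf: "limit_field C (2 * k) I t x = (\<lambda>\<omega>. sqrt C * Re (I (heat_mode (2 * k) t x) \<omega>))" for t x
    by (simp add: limit_field_def heat_mode_def[abs_def] fun_eq_iff)
  have mean: "expectation (limit_field C (2 * k) I t x) = 0" if "t > 0" for t x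
    using I_integrable[OF sq_int_heat_mode[OF that k, of x]] I_mean[OF sq_int_heat_mode[OF that k, of x]]
    by (simp add: lf)
  \<comment> \<open>For an even order the mode has Hermitian symmetry and equals its own
    \<open>sym_part\<close>, so its integral is almost surely real. The product of real parts is
    then the real part of the sesquilinear product in the isometry.\<close>
  have real: "AE \<omega> in P. I (heat_mode (2 * k) t x) \<omega> = complex_of_real (Re (I (heat_mode (2 * k) t x) \<omega>))" if "t > 0" for t x
  proof -
    have "sym_part (heat_mode (2 * k) t x) = heat_mode (2 * k) t x"
      by (simp add: sym_part_def fun_eq_iff cnj_heat_mode)
    then show ?thesis using Re_I[OF sq_int_heat_mode[OF that k, of x]] by simp
  qed
  note s = sq_int_heat_mode[OF t k, of x] and s' = sq_int_heat_mode[OF t' k, of x']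
  note [measurable] = I_measurable[OF s] I_measurable[OF s']
  have prod: "integrable P (\<lambda>\<omega>. I (heat_mode (2 * k) t x) \<omega> * cnj (I (heat_mode (2 * k) t' x') \<omega>))"
    by (rule I_prod_integrable[OF s s'])
  have hm: "integrable lborel (heat_mode (2 * k) (t + t') (x - x'))"
  proof (rule Bochner_Integration.integrable_bound)
    show "integrable lborel (\<lambda>l. exp (- (t + t') * l ^ (2 * k)))"
      using t t' k by (intro integrable_exp_even_power) auto
    show "AE l in lborel. norm (heat_mode (2 * k) (t + t') (x - x') l) \<le> norm (exp (- (t + t') * l ^ (2 * k)))"
      by (intro AE_I2) (simp add: norm_heat_mode algebra_simps)
  qed measurable
  have "expectation (\<lambda>\<omega>. Re (I (heat_mode (2 * k) t x) \<omega>) * Re (I (heat_mode (2 * k) t' x') \<omega>)) =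
     expectation (\<lambda>\<omega>. Re (I (heat_mode (2 * k) t x) \<omega> * cnj (I (heat_mode (2 * k) t' x') \<omega>)))"
  proof (intro integral_cong_AE)
    show "AE \<omega> in P. Re (I (heat_mode (2 * k) t x) \<omega>) * Re (I (heat_mode (2 * k) t' x') \<omega>) =
        Re (I (heat_mode (2 * k) t x) \<omega> * cnj (I (heat_mode (2 * k) t' x') \<omega>))"
      using real[OF t, of x]
    proof eventually_elim
      case (elim \<omega>)
      from arg_cong[OF elim, of Im] have "Im (I (heat_mode (2 * k) t x) \<omega>) = 0" by simp
      then show ?case by simp
    qed
    show "(\<lambda>\<omega>. Re (I (heat_mode (2 * k) t x) \<omega> * cnj (I (heat_mode (2 * k) t' x') \<omega>))) \<in> borel_measurable P"
      using borel_measurable_integrable[OF prod] by measurable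
  qed measurable
  also have "\<dots> = Re (LINT l|lborel. heat_mode (2 * k) (t + t') (x - x') l)"
    using I_isometry[OF s s'] unfolding integral_Re[OF prod] heat_mode_mult_cnj by simp
  also have "\<dots> = (LINT l|lborel. cos (l * (x - x')) * exp (- (t + t') * l ^ (2 * k)))"
    unfolding integral_Re[OF hm, symmetric] Re_heat_mode ..
  finally have *: "expectation (\<lambda>\<omega>. Re (I (heat_mode (2 * k) t x) \<omega>) * Re (I (heat_mode (2 * k) t' x') \<omega>)) =
     (LINT l|lborel. cos (l * (x - x')) * exp (- (t + t') * l ^ (2 * k)))" .
  have "expectation (\<lambda>\<omega>. limit_field C (2 * k) I t x \<omega> * limit_field C (2 * k) I t' x' \<omega>) =
     expectation (\<lambda>\<omega>. C * (Re (I (heat_mode (2 * k) t x) \<omega>) * Re (I (heat_mode (2 * k) t' x') \<omega>)))"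
    unfolding lf using C by (intro Bochner_Integration.integral_cong) (auto simp: algebra_simps)
  then show ?thesis using * by (simp add: mean t t')
qed

end

theorem theorem2:
  fixes P :: "'a measure"
    and M :: "real \<Rightarrow> real"
    and I :: "(real \<Rightarrow> complex) \<Rightarrow> 'a \<Rightarrow> complex"
    and k n :: nat
    and A w \<kappa> :: "nat \<Rightarrow> real"
    and r f :: "real \<Rightarrow> real"
  assumes "prob_space P" and "complete_measure P"
    and "k \<ge> 1"
    and "white_noise_integral P I"
    and "\<forall>j\<le>n. A j \<ge> 0" and "(\<Sum>j\<le>n. A j) = 1"
    and "w 0 = 0" and "\<forall>j\<in>{1..n}. w j \<noteq> 0"
    and "\<forall>j\<le>n. 0 < \<kappa> j \<and> \<kappa> j < 1"
    and "A 0 = 0"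
    and "\<forall>x. r x = (\<Sum>j\<le>n. A j * cos (w j * x) / (1 + x\<^sup>2) powr (\<kappa> j / 2))"
    and "f \<in> borel_measurable lborel" and "\<forall>l. f l \<ge> 0" and "integrable lborel f"
    and "\<forall>x. complex_of_real (r x) =
              (LINT l|lborel. exp (\<i> * complex_of_real (l * x)) * complex_of_real (f l))"
    and "\<forall>t>0. \<forall>x. integrable lborel
              (\<lambda>y. complex_of_real (M (x - y)) * fund_sol (2 * k) t y)"
  shows
    "(\<forall>(tt :: 'n::finite \<Rightarrow> real) (xx :: 'n \<Rightarrow> real) (h :: real ^ 'n \<Rightarrow> real).
        (\<forall>i. tt i > 0) \<longrightarrow> continuous_on UNIV h \<longrightarrow> bounded (range h) \<longrightarrow>
        ((\<lambda>\<epsilon>. LINT \<omega>|P. h (\<chi> i. rescaled_field P M (2 * k) f I \<epsilon> (tt i) (xx i) \<omega>))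
          \<longlongrightarrow> (LINT \<omega>|P. h (\<chi> i. limit_field (const_C n A w \<kappa>) (2 * k) I (tt i) (xx i) \<omega>)))
         (at_right 0))
     \<and> (\<forall>t t' x x'. t > 0 \<longrightarrow> t' > 0 \<longrightarrow>
        (LINT \<omega>|P. (limit_field (const_C n A w \<kappa>) (2 * k) I t x \<omega>
                      - (LINT \<omega>'|P. limit_field (const_C n A w \<kappa>) (2 * k) I t x \<omega>')) *
                    (limit_field (const_C n A w \<kappa>) (2 * k) I t' x' \<omega>
                      - (LINT \<omega>'|P. limit_field (const_C n A w \<kappa>) (2 * k) I t' x' \<omega>')))
          = const_C n A w \<kappa> * (LINT l|lborel. cos (l * (x - x')) * exp (- (t + t') * l ^ (2 * k)))
        \<and> const_C n A w \<kappa> * (LINT l|lborel. cos (l * (x - x')) * exp (- (t + t') * l ^ (2 * k)))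
          = 2 * sqrt pi * const_C n A w \<kappa> / (real (2 * k) * (t + t') powr (1 / real (2 * k))) *
            fox_wright_11 (1 / real (2 * k)) (2 / real (2 * k)) (1 / 2) 1
              (- (x - x')\<^sup>2 / (4 * (t + t') powr (2 / real (2 * k)))))"
proof -
  interpret white_noise P I
    using assms(1,4) by (simp add: white_noise_def white_noise_axioms_def)
  define g where "g = spectral_density n A w \<kappa>"
  have \<kappa>: "\<forall>j\<le>n. 0 < \<kappa> j" using assms(9) by auto
  have g: "g \<in> borel_measurable borel" unfolding g_def by measurable
  have gnn: "\<And>l. 0 \<le> g l" unfolding g_def by (intro spectral_density_nonneg assms(5) \<kappa>)
  have gF: "has_bochner_integral lborel (\<lambda>l. exp (\<i> * complex_of_real (l * x)) * complex_of_real (g l)) (complex_of_real (r x))" for x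
    unfolding g_def using fourier_transform_spectral_density[OF \<kappa>] assms(11) by simp
  \<comment> \<open>At \<open>x = 0\<close> the exponential is 1, so the Fourier statement already
    contains integrability.\<close>
  have gint: "integrable lborel g"
    using integrable_Re[OF integrable.intros[OF gF[of 0]]] by simp
  have g0: "g 0 = const_C n A w \<kappa>" and gcont: "isCont g 0"
    unfolding g_def
    by (intro spectral_density_0 isCont_spectral_density_0 assms(10,8) \<kappa>)+
  have f: "f \<in> borel_measurable borel" "\<And>l. 0 \<le> f l" using assms(12,13) by auto
  \<comment> \<open>At 0 every cosine and every denominator is 1, so the weights sum to the unit
    mass needed for uniqueness.\<close>
  have "r 0 = 1" using assms(6,11) by simp
  then have "(LINT l|lborel. f l) = 1"
    using arg_cong[OF assms(15)[rule_format, of 0], of Re] by simp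
  then have eq: "AE l in lborel. f l = g l"
    using assms(15) has_bochner_integral_integral_eq[OF gF]
    by (intro fourier_transform_density_unique f g gnn assms(14) gint) auto
  \<comment> \<open>As a value of a nonnegative density the constant has the sign needed for
    \<open>sqrt C * sqrt C = C\<close>.\<close>
  have C: "const_C n A w \<kappa> \<ge> 0" using gnn[of 0] by (simp add: g0)
  show ?thesis
  proof (intro conjI allI impI)
    fix tt xx :: "'n \<Rightarrow> real" and h :: "real ^ 'n \<Rightarrow> real"
    assume "\<forall>i. tt i > 0" "continuous_on UNIV h" "bounded (range h)"
    then show "((\<lambda>\<epsilon>. LINT \<omega>|P. h (\<chi> i. rescaled_field P M (2 * k) f I \<epsilon> (tt i) (xx i) \<omega>))
          \<longlongrightarrow> (LINT \<omega>|P. h (\<chi> i. limit_field (const_C n A w \<kappa>) (2 * k) I (tt i) (xx i) \<omega>))) (at_right 0)"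
      unfolding g0[symmetric]
      by (intro rescaled_field_tendsto assms(3) f assms(14) g gnn gint gcont eq) auto
  next
    fix t t' x x' :: real assume t: "t > 0" "t' > 0"
    show "(LINT \<omega>|P. (limit_field (const_C n A w \<kappa>) (2 * k) I t x \<omega>
                      - (LINT \<omega>'|P. limit_field (const_C n A w \<kappa>) (2 * k) I t x \<omega>')) *
                    (limit_field (const_C n A w \<kappa>) (2 * k) I t' x' \<omega>
                      - (LINT \<omega>'|P. limit_field (const_C n A w \<kappa>) (2 * k) I t' x' \<omega>')))
          = const_C n A w \<kappa> * (LINT l|lborel. cos (l * (x - x')) * exp (- (t + t') * l ^ (2 * k)))"
      by (rule limit_field_covariance[OF assms(3) C t])
    show "const_C n A w \<kappa> * (LINT l|lborel. cos (l * (x - x')) * exp (- (t + t') * l ^ (2 * k)))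
          = 2 * sqrt pi * const_C n A w \<kappa> / (real (2 * k) * (t + t') powr (1 / real (2 * k))) *
            fox_wright_11 (1 / real (2 * k)) (2 / real (2 * k)) (1 / 2) 1
              (- (x - x')\<^sup>2 / (4 * (t + t') powr (2 / real (2 * k))))"
      using t by (subst integral_cos_exp_even_power_fox_wright[OF _ assms(3)]) auto
  qed
qed

end
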